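(* Consider a one-step scheme (as defined in the context). Assume that, for some given grid $\pi$ and for all $i\le n-1$, the functions $\Phi_i^Y,\Phi_i^Z$ satisfy, for all $U,V,\tilde U,\tilde V\in L^2(\mathcal F_{t_{i+1}})$, with $\delta U:=U-\tilde U$ and $\delta V:=V-\tilde V$, $$\mathbb E_{t_i}\big[|\Phi_i^Y(t_{i+1},U,V,h_i)-\Phi_i^Y(t_{i+1},\tilde U,\tilde V,h_i)|^2\big]\le C\Big(\frac1{h_i}\big(\mathbb E_{t_i}[|\delta U|^2]-|\mathbb E_{t_i}[\delta U]|^2\big)+\mathbb E_{t_i}[|\delta U|^2+|\delta V|^2]\Big),$$ $$\mathbb E_{t_i}\big[|\Phi_i^Z(t_{i+1},U,V,h_i)-\Phi_i^Z(t_{i+1},\tilde U,\tilde V,h_i)|^2\big]\le \frac{C}{h_i}\Big(\frac1{h_i}\big(\mathbb E_{t_i}[|\delta U|^2]-|\mathbb E_{t_i}[\delta U]|^2\big)+\mathbb E_{t_i}[|\delta U|^2+|\delta V|^2]\Big).$$ Then the scheme is $L^2$-stable.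
   Context: Fix $T>0$, $d\ge1$, and a filtered probability space $(\Omega,\mathcal F,(\mathcal F_t)_{t\ge0},\mathbb P)$ with a $d$-dimensional $(\mathcal F_t)$-Brownian motion $W$. $\mathbb E_t[\cdot]=\mathbb E[\cdot\mid\mathcal F_t]$; $L^2(\mathcal F_t)$ is the space of square-integrable $\mathcal F_t$-measurable random variables (real-valued for $Y$-components, $\mathbb R^d$-valued row vectors for $Z$-components). A grid is $\pi=\{0=t_0<\dots<t_n=T\}$, with $h_i=t_{i+1}-t_i$ and $|\pi|=\max_i h_i$. One-step scheme: the terminal condition is a pair $(Y_n,Z_n)\in L^2(\mathcal F_T)$ and, for $i\le n-1$, $$Y_i=\mathbb E_{t_i}[Y_{i+1}+h_i\Phi_i^Y(t_{i+1},Y_{i+1},Z_{i+1},h_i)],\qquad Z_i=\mathbb E_{t_i}[H^i_{q+1}Y_{i+1}+h_i\Phi_i^Z(t_{i+1},Y_{i+1},Z_{i+1},h_i)],$$ where $\Phi_i^Y,\Phi_i^Z$ are functions from $\mathbb R_+\times L^2(\mathcal F_{t_{i+1}})\times L^2(\mathcal F_{t_{i+1}})\times(0,\infty)$ to $L^2(\mathcal F_{t_{i+1}})$, and $H^i_{q+1}$ is an $\mathcal F_{t_{i+1}}$-measurable $\mathbb R^d$-valued (row) random vector with $\mathbb E_{t_i}[H^i_{q+1}]=0$ and $\mathbb E[h_i|H^i_{q+1}|^2]\le\Lambda$, with $\Lambda$ a positive constant independent of $\pi$. Perturbed scheme: given $\zeta^Y_i,\zeta^Z_i\in L^2(\mathcal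 F_{t_{i+1}})$ for $i<n$ and $(\tilde Y_n,\tilde Z_n)\in L^2(\mathcal F_T)$, set $$\tilde Y_i=\mathbb E_{t_i}[\tilde Y_{i+1}+h_i\Phi_i^Y(t_{i+1},\tilde Y_{i+1},\tilde Z_{i+1},h_i)+\zeta_i^Y],\quad \tilde Z_i=\mathbb E_{t_i}[H^i_{q+1}\tilde Y_{i+1}+h_i\Phi_i^Z(t_{i+1},\tilde Y_{i+1},\tilde Z_{i+1},h_i)+\zeta_i^Z].$$ Put $\delta Y_i=Y_i-\tilde Y_i$, $\delta Z_i=Z_i-\tilde Z_i$. $L^2$-stability: the scheme is $L^2$-stable if $$\max_i\mathbb E[|\delta Y_i|^2]+\sum_{i=0}^{n-1}h_i\mathbb E[|\delta Z_i|^2]\le C\Big(\mathbb E[|\delta Y_n|^2+h_{n-1}|\delta Z_n|^2]+\sum_{i=0}^{n-1}h_i\mathbb E\Big[\frac1{h_i^2}|\mathbb E_{t_i}[\zeta_i^Y]|^2+|\mathbb E_{t_i}[\zeta_i^Z]|^2\Big]\Big)$$ for all sequences $\zeta^Y_i,\zeta^Z_i$ in $L^2(\mathcal F_{t_{i+1}})$ and all terminal values $(Y_n,Z_n),(\tilde Y_n,\tilde Z_n)$ in $L^2(\mathcal F_T)$. Convention: $C$ denotes a positive constant which may change from line to line and may depend on $T,d,\Lambda,X_0$, where $X_0$ is the initial value of the underlying forward diffusion (and here, in the conclusion, on the constant in the hypothesis), but not on the choice of the partition $\pi$.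
   Formalization: The constant C may also depend on the largest ratio h_i/h_{i+1} of consecutive steps (no constant serves all grids), and the bound on the weights is taken conditionally, E_{t_i}[h_i|H^i|^2] ≤ Λ a.s., since the claim fails with only the unconditional bound. *)

theory Defs
  imports "HOL-Probability.Probability"
begin

text \<open>Filtered probability space and Brownian motion.  The time index is a real number; only times
  \<open>t \<ge> 0\<close> are constrained.\<close>

locale filtered_prob_space = prob_space M
  for M :: "'a measure" +
  fixes F :: "real \<Rightarrow> 'a measure"
  assumes subalgebra_F: "0 \<le> t \<Longrightarrow> subalgebra M (F t)"
    and F_mono: "0 \<le> s \<Longrightarrow> s \<le> t \<Longrightarrow> subalgebra (F t) (F s)"

locale brownian_motion = filtered_prob_space M F
  for M :: "'a measure" and F :: "real \<Rightarrow> 'a measure" +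
  fixes W :: "real \<Rightarrow> 'a \<Rightarrow> real ^ 'd"
  assumes adapted: "0 \<le> t \<Longrightarrow> W t \<in> borel_measurable (F t)"
    and initial: "AE \<omega> in M. W 0 \<omega> = 0"
    and continuous_paths: "AE \<omega> in M. continuous_on {0..} (\<lambda>t. W t \<omega>)"
    and increments_independent_of_past: "0 \<le> s \<Longrightarrow> s < t \<Longrightarrow>
      indep_set (sets (F s)) (sets (vimage_algebra (space M) (\<lambda>\<omega>. W t \<omega> - W s \<omega>) borel))"
    and increment_components_normal: "0 \<le> s \<Longrightarrow> s < t \<Longrightarrow>
      distributed M lborel (\<lambda>\<omega>. (W t \<omega> - W s \<omega>) $ j) (normal_density 0 (sqrt (t - s)))"
    and increment_components_independent: "0 \<le> s \<Longrightarrow> s < t \<Longrightarrow>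
      indep_vars (\<lambda>_. borel) (\<lambda>j \<omega>. (W t \<omega> - W s \<omega>) $ j) UNIV"

text \<open>Random variables are functions, not classes modulo null sets; equations and inequalities
  between them are therefore required almost everywhere.\<close>

definition L2 :: "'a measure \<Rightarrow> 'a measure \<Rightarrow> ('a \<Rightarrow> 'b::real_normed_vector) set" where
  "L2 M G = {X. X \<in> borel_measurable G \<and> integrable M (\<lambda>\<omega>. (norm (X \<omega>))\<^sup>2)}"

text \<open>The library's conditional expectation is real-valued; for row vectors it is taken
  componentwise.\<close>

definition vec_cond_exp ::
  "'a measure \<Rightarrow> 'a measure \<Rightarrow> ('a \<Rightarrow> real ^ 'd) \<Rightarrow> 'a \<Rightarrow> real ^ 'd" where
  "vec_cond_exp M G X = (\<lambda>\<omega>. \<chi> j. real_cond_exp M G (\<lambda>\<omega>'. X \<omega>' $ j) \<omega>)"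

definition is_grid :: "real \<Rightarrow> nat \<Rightarrow> (nat \<Rightarrow> real) \<Rightarrow> bool" where
  "is_grid T n t \<longleftrightarrow> 0 < n \<and> t 0 = 0 \<and> t n = T \<and> (\<forall>i<n. t i < t (Suc i))"

definition step :: "(nat \<Rightarrow> real) \<Rightarrow> nat \<Rightarrow> real" where
  "step t i = t (Suc i) - t i"

text \<open>The largest ratio \<open>h\<^sub>i / h\<^sub>i\<^sub>+\<^sub>1\<close> of two consecutive steps, but at least 1; it is 1 for a
  uniform grid and for a grid with a single step.  A stability constant cannot be uniform over grids
  for which this ratio is unbounded: with \<open>\<Phi>\<^sup>Y\<^sub>0(s, U, V, h) = V\<close> and two steps, \<open>\<delta>Y\<^sub>0\<close> is of order
  \<open>h\<^sub>0 / sqrt h\<^sub>1\<close> when \<open>E[|\<delta>Y\<^sub>2|\<^sup>2] = 1\<close>.\<close>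

definition step_ratio :: "nat \<Rightarrow> (nat \<Rightarrow> real) \<Rightarrow> real" where
  "step_ratio n t = Max (insert 1 {step t i / step t (Suc i) | i. Suc i < n})"

text \<open>The generators \<open>\<Phi>\<^sup>Y\<^sub>i\<close>, \<open>\<Phi>\<^sup>Z\<^sub>i\<close> act on whole random variables.\<close>

type_synonym ('a, 'd, 'b) generator =
  "nat \<Rightarrow> real \<Rightarrow> ('a \<Rightarrow> real) \<Rightarrow> ('a \<Rightarrow> real ^ 'd) \<Rightarrow> real \<Rightarrow> 'a \<Rightarrow> 'b"

definition generator_maps_L2 ::
  "'a measure \<Rightarrow> (real \<Rightarrow> 'a measure) \<Rightarrow> nat \<Rightarrow> (nat \<Rightarrow> real)
    \<Rightarrow> ('a, 'd::finite, 'b::real_normed_vector) generator \<Rightarrow> bool" where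
  "generator_maps_L2 M F n t \<Phi> \<longleftrightarrow>
    (\<forall>i<n. \<forall>s\<ge>0. \<forall>h>0. \<forall>U \<in> L2 M (F (t (Suc i))). \<forall>V \<in> L2 M (F (t (Suc i))).
      \<Phi> i s U V h \<in> L2 M (F (t (Suc i))))"

text \<open>Bound on the weights: the second moment is conditional on \<open>F (t i)\<close>.  For weights that are
  independent of \<open>F (t i)\<close> this is \<open>E[h\<^sub>i |H\<^sub>i|\<^sup>2] \<le> \<Lambda>\<close>.\<close>

definition admissible_weights ::
  "'a measure \<Rightarrow> (real \<Rightarrow> 'a measure) \<Rightarrow> real \<Rightarrow> nat \<Rightarrow> (nat \<Rightarrow> real)
    \<Rightarrow> (nat \<Rightarrow> 'a \<Rightarrow> real ^ 'd) \<Rightarrow> bool" where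
  "admissible_weights M F \<Lambda> n t H \<longleftrightarrow>
    (\<forall>i<n. H i \<in> L2 M (F (t (Suc i)))
      \<and> (AE \<omega> in M. vec_cond_exp M (F (t i)) (H i) \<omega> = 0)
      \<and> (AE \<omega> in M. real_cond_exp M (F (t i)) (\<lambda>\<omega>'. step t i * (norm (H i \<omega>'))\<^sup>2) \<omega> \<le> \<Lambda>))"

definition one_step_scheme ::
  "'a measure \<Rightarrow> (real \<Rightarrow> 'a measure) \<Rightarrow> real \<Rightarrow> nat \<Rightarrow> (nat \<Rightarrow> real)
    \<Rightarrow> (nat \<Rightarrow> 'a \<Rightarrow> real ^ 'd) \<Rightarrow> ('a, 'd, real) generator \<Rightarrow> ('a, 'd, real ^ 'd) generator
    \<Rightarrow> bool" where
  "one_step_scheme M F \<Lambda> n t H \<Phi>Y \<Phi>Z \<longleftrightarrow>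
    admissible_weights M F \<Lambda> n t H \<and> generator_maps_L2 M F n t \<Phi>Y \<and> generator_maps_L2 M F n t \<Phi>Z"

text \<open>For \<open>i < n\<close> only measurability of \<open>Y i\<close>, \<open>Z i\<close> is required here: their square-integrability
  follows from that of the terminal pair.\<close>

definition perturbed_solution ::
  "'a measure \<Rightarrow> (real \<Rightarrow> 'a measure) \<Rightarrow> nat \<Rightarrow> (nat \<Rightarrow> real)
    \<Rightarrow> (nat \<Rightarrow> 'a \<Rightarrow> real ^ 'd) \<Rightarrow> ('a, 'd, real) generator \<Rightarrow> ('a, 'd, real ^ 'd) generator
    \<Rightarrow> (nat \<Rightarrow> 'a \<Rightarrow> real) \<Rightarrow> (nat \<Rightarrow> 'a \<Rightarrow> real ^ 'd)
    \<Rightarrow> (nat \<Rightarrow> 'a \<Rightarrow> real) \<Rightarrow> (nat \<Rightarrow> 'a \<Rightarrow> real ^ 'd) \<Rightarrow> bool" where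
  "perturbed_solution M F n t H \<Phi>Y \<Phi>Z \<zeta>Y \<zeta>Z Y Z \<longleftrightarrow>
    Y n \<in> L2 M (F (t n)) \<and> Z n \<in> L2 M (F (t n)) \<and>
    (\<forall>i<n. Y i \<in> borel_measurable (F (t i)) \<and> Z i \<in> borel_measurable (F (t i)) \<and>
      (AE \<omega> in M. Y i \<omega> = real_cond_exp M (F (t i)) (\<lambda>\<omega>'. Y (Suc i) \<omega>'
          + step t i * \<Phi>Y i (t (Suc i)) (Y (Suc i)) (Z (Suc i)) (step t i) \<omega>' + \<zeta>Y i \<omega>') \<omega>) \<and>
      (AE \<omega> in M. Z i \<omega> = vec_cond_exp M (F (t i)) (\<lambda>\<omega>'. Y (Suc i) \<omega>' *\<^sub>R H i \<omega>'
          + step t i *\<^sub>R \<Phi>Z i (t (Suc i)) (Y (Suc i)) (Z (Suc i)) (step t i) \<omega>' + \<zeta>Z i \<omega>') \<omega>))"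

abbreviation scheme_solution ::
  "'a measure \<Rightarrow> (real \<Rightarrow> 'a measure) \<Rightarrow> nat \<Rightarrow> (nat \<Rightarrow> real)
    \<Rightarrow> (nat \<Rightarrow> 'a \<Rightarrow> real ^ 'd) \<Rightarrow> ('a, 'd, real) generator \<Rightarrow> ('a, 'd, real ^ 'd) generator
    \<Rightarrow> (nat \<Rightarrow> 'a \<Rightarrow> real) \<Rightarrow> (nat \<Rightarrow> 'a \<Rightarrow> real ^ 'd) \<Rightarrow> bool" where
  "scheme_solution M F n t H \<Phi>Y \<Phi>Z \<equiv>
    perturbed_solution M F n t H \<Phi>Y \<Phi>Z (\<lambda>_ _. 0) (\<lambda>_ _. 0)"

definition L2_stable ::
  "'a measure \<Rightarrow> (real \<Rightarrow> 'a measure) \<Rightarrow> nat \<Rightarrow> (nat \<Rightarrow> real)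
    \<Rightarrow> (nat \<Rightarrow> 'a \<Rightarrow> real ^ 'd) \<Rightarrow> ('a, 'd, real) generator \<Rightarrow> ('a, 'd, real ^ 'd) generator
    \<Rightarrow> real \<Rightarrow> bool" where
  "L2_stable M F n t H \<Phi>Y \<Phi>Z C \<longleftrightarrow>
    (\<forall>\<zeta>Y \<zeta>Z Y Z Y' Z'.
      (\<forall>i<n. \<zeta>Y i \<in> L2 M (F (t (Suc i))) \<and> \<zeta>Z i \<in> L2 M (F (t (Suc i)))) \<longrightarrow>
      scheme_solution M F n t H \<Phi>Y \<Phi>Z Y Z \<longrightarrow>
      perturbed_solution M F n t H \<Phi>Y \<Phi>Z \<zeta>Y \<zeta>Z Y' Z' \<longrightarrow>
      Max ((\<lambda>i. \<integral>\<omega>. (Y i \<omega> - Y' i \<omega>)\<^sup>2 \<partial>M) ` {..n})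
        + (\<Sum>i<n. step t i * (\<integral>\<omega>. (norm (Z i \<omega> - Z' i \<omega>))\<^sup>2 \<partial>M))
      \<le> C * ((\<integral>\<omega>. (Y n \<omega> - Y' n \<omega>)\<^sup>2 + step t (n - 1) * (norm (Z n \<omega> - Z' n \<omega>))\<^sup>2 \<partial>M)
        + (\<Sum>i<n. step t i *
            (\<integral>\<omega>. 1 / (step t i)\<^sup>2 * (real_cond_exp M (F (t i)) (\<zeta>Y i) \<omega>)\<^sup>2
              + (norm (vec_cond_exp M (F (t i)) (\<zeta>Z i) \<omega>))\<^sup>2 \<partial>M))))"

text \<open>\<open>increment_bound M G h U U' V V'\<close> is
  \<open>(E[|\<delta>U|\<^sup>2 | G] - |E[\<delta>U | G]|\<^sup>2) / h + E[|\<delta>U|\<^sup>2 + |\<delta>V|\<^sup>2 | G]\<close>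
  with \<open>\<delta>U = U - U'\<close>, \<open>\<delta>V = V - V'\<close>.\<close>

definition increment_bound ::
  "'a measure \<Rightarrow> 'a measure \<Rightarrow> real \<Rightarrow> ('a \<Rightarrow> real) \<Rightarrow> ('a \<Rightarrow> real)
    \<Rightarrow> ('a \<Rightarrow> real ^ 'd) \<Rightarrow> ('a \<Rightarrow> real ^ 'd) \<Rightarrow> 'a \<Rightarrow> real" where
  "increment_bound M G h U U' V V' \<omega> =
    1 / h * (real_cond_exp M G (\<lambda>\<omega>'. (U \<omega>' - U' \<omega>')\<^sup>2) \<omega>
              - (real_cond_exp M G (\<lambda>\<omega>'. U \<omega>' - U' \<omega>') \<omega>)\<^sup>2)
    + real_cond_exp M G (\<lambda>\<omega>'. (U \<omega>' - U' \<omega>')\<^sup>2 + (norm (V \<omega>' - V' \<omega>'))\<^sup>2) \<omega>"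

definition generators_Lipschitz ::
  "'a measure \<Rightarrow> (real \<Rightarrow> 'a measure) \<Rightarrow> real \<Rightarrow> nat \<Rightarrow> (nat \<Rightarrow> real)
    \<Rightarrow> ('a, 'd::finite, real) generator \<Rightarrow> ('a, 'd, real ^ 'd) generator \<Rightarrow> bool" where
  "generators_Lipschitz M F K n t \<Phi>Y \<Phi>Z \<longleftrightarrow>
    (\<forall>i<n. \<forall>U \<in> L2 M (F (t (Suc i))). \<forall>U' \<in> L2 M (F (t (Suc i))).
           \<forall>V \<in> L2 M (F (t (Suc i))). \<forall>V' \<in> L2 M (F (t (Suc i))).
      (AE \<omega> in M. real_cond_exp M (F (t i)) (\<lambda>\<omega>'. (\<Phi>Y i (t (Suc i)) U V (step t i) \<omega>'
            - \<Phi>Y i (t (Suc i)) U' V' (step t i) \<omega>')\<^sup>2) \<omega>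
          \<le> K * increment_bound M (F (t i)) (step t i) U U' V V' \<omega>) \<and>
      (AE \<omega> in M. real_cond_exp M (F (t i)) (\<lambda>\<omega>'. (norm (\<Phi>Z i (t (Suc i)) U V (step t i) \<omega>'
            - \<Phi>Z i (t (Suc i)) U' V' (step t i) \<omega>'))\<^sup>2) \<omega>
          \<le> K / step t i * increment_bound M (F (t i)) (step t i) U U' V V' \<omega>))"

end

theory Submission
  imports Defs
begin

text \<open>Let \<open>D\<close> be the error of \<open>Y (i+1)\<close>.  Since the weight \<open>H i\<close> has vanishing conditional mean, the
  conditional Cauchy--Schwarz inequality bounds \<open>|E[H D | F]|\<^sup>2\<close> by \<open>\<Lambda> / h\<close> times the conditional
  variance of \<open>D\<close>; on the other hand, replacing \<open>E[D\<^sup>2]\<close> by \<open>E[E[D | F]\<^sup>2]\<close> in the estimate of the error of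
  \<open>Y i\<close> gains exactly that variance.  With \<open>w i = h i * E[|\<delta>Z i|\<^sup>2]\<close>, a small multiple \<open>c\<close> of \<open>w i\<close> can
  therefore be added to \<open>E[|\<delta>Y i|\<^sup>2]\<close>, and a large weight \<open>\<eta>\<close> in Young's inequality makes the
  contribution of \<open>w (i+1)\<close> at most \<open>c/2 + O(h)\<close>, where the step ratio enters because only
  \<open>h (i+1)\<close>, not \<open>h i\<close>, occurs in \<open>w (i+1)\<close>.  The remaining \<open>c/2 * w (i+1)\<close> sums up to the bound on the
  \<open>Z\<close>-errors, and no smallness of the steps is needed.\<close>

section \<open>Elementary inequalities for squared norms\<close>

lemma norm_add_squared_le:
  "(norm (x + y))\<^sup>2 \<le> 2 * (norm x)\<^sup>2 + 2 * (norm y)\<^sup>2" for x y :: "'b::real_normed_vector"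
proof -
  have "(norm (x + y))\<^sup>2 \<le> (norm x + norm y)\<^sup>2"
    by (intro power_mono norm_triangle_ineq) simp
  also have "\<dots> \<le> 2 * (norm x)\<^sup>2 + 2 * (norm y)\<^sup>2"
    using sum_squares_bound[of "norm x" "norm y"] by (simp add: power2_sum)
  finally show ?thesis .
qed

text \<open>Young's inequality, from the nonnegativity of
  \<open>(\<theta> * x - y)\<^sup>2 / \<theta>\<close>. The weight stays free: with
  \<open>\<theta>\<close> proportional to the step, the main term \<open>x\<close> grows only by a
  factor 1 + O(h), and the factor 1/h on \<open>y\<close> is affordable because the generator part
  of \<open>y\<close> carries a factor h.\<close>

lemma weighted_square_add_le:
  fixes x y \<theta> :: real
  assumes "0 < \<theta>"
  shows "(x + y)\<^sup>2 \<le> (1 + \<theta>) * x\<^sup>2 + (1 + 1 / \<theta>) * y\<^sup>2"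
proof -
  have "0 \<le> (\<theta> * x - y)\<^sup>2 / \<theta>"
    using assms by simp
  also have "\<dots> = \<theta> * x\<^sup>2 - 2 * x * y + y\<^sup>2 / \<theta>"
    using assms by (simp add: power2_eq_square field_simps)
  finally show ?thesis
    by (simp add: power2_sum algebra_simps)
qed

lemma norm_diff_squared_le:
  "(norm (x - y))\<^sup>2 \<le> 2 * (norm x)\<^sup>2 + 2 * (norm y)\<^sup>2" for x y :: "'b::real_normed_vector"
  using norm_add_squared_le[of x "- y"] by simp

lemma norm_add_add_squared_le:
  "(norm (x + y + z))\<^sup>2 \<le> 3 * ((norm x)\<^sup>2 + (norm y)\<^sup>2 + (norm z)\<^sup>2)"
  for x y z :: "'b::real_normed_vector"
proof -
  have "(norm (x + y + z))\<^sup>2 \<le> (norm x + norm y + norm z)\<^sup>2"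
    by (intro power_mono norm_ge_zero) (meson norm_triangle_ineq norm_triangle_le add_mono order_refl order_trans)
  also have "\<dots> \<le> 3 * ((norm x)\<^sup>2 + (norm y)\<^sup>2 + (norm z)\<^sup>2)"
    using sum_squares_bound[of "norm x" "norm y"] sum_squares_bound[of "norm y" "norm z"]
      sum_squares_bound[of "norm x" "norm z"]
    by (simp add: power2_eq_square algebra_simps)
  finally show ?thesis .
qed

lemma norm_vec_squared: "(norm x)\<^sup>2 = (\<Sum>j\<in>UNIV. (x $ j)\<^sup>2)" for x :: "real ^ 'd"
  unfolding power2_norm_eq_inner inner_vec_def by (simp add: power2_eq_square)

section \<open>Square-integrable random variables\<close>

lemma L2_D:
  assumes "X \<in> L2 M G"
  shows "X \<in> borel_measurable G" "integrable M (\<lambda>\<omega>. (norm (X \<omega>))\<^sup>2)"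
  using assms by (auto simp: L2_def)

lemma L2_subalgebra:
  assumes "subalgebra G G'" "X \<in> L2 M G'"
  shows "X \<in> L2 M G"
  using assms measurable_from_subalg by (auto simp: L2_def)

lemma L2_real_square: "X \<in> L2 M G \<Longrightarrow> integrable M (\<lambda>\<omega>. (X \<omega>)\<^sup>2)" for X :: "'a \<Rightarrow> real"
  by (auto simp: L2_def)

lemma subalgebra_refl: "subalgebra M M"
  by (simp add: subalgebra_def)

lemma L2_add:
  fixes X Y :: "'a \<Rightarrow> 'b::{second_countable_topology, real_normed_vector}"
  assumes "subalgebra M G" "X \<in> L2 M G" "Y \<in> L2 M G"
  shows "(\<lambda>\<omega>. X \<omega> + Y \<omega>) \<in> L2 M G"
proof -
  note [measurable] = L2_D(1)[OF assms(2)] L2_D(1)[OF assms(3)]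
  have 1: "(\<lambda>\<omega>. X \<omega> + Y \<omega>) \<in> borel_measurable G" by measurable
  note [measurable] = measurable_from_subalg[OF assms(1) 1]
  have "integrable M (\<lambda>\<omega>. (norm (X \<omega> + Y \<omega>))\<^sup>2)"
    by (rule Bochner_Integration.integrable_bound
          [of _ "\<lambda>\<omega>. 2 * (norm (X \<omega>))\<^sup>2 + 2 * (norm (Y \<omega>))\<^sup>2"])
       (use norm_add_squared_le[of "X _" "Y _"] assms in \<open>auto simp: L2_def\<close>)
  with 1 show ?thesis by (simp add: L2_def)
qed

lemma L2_scaleR:
  fixes X :: "'a \<Rightarrow> 'b::{second_countable_topology, real_normed_vector}"
  assumes "X \<in> L2 M G"
  shows "(\<lambda>\<omega>. c *\<^sub>R X \<omega>) \<in> L2 M G"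
  using assms by (auto simp: L2_def power_mult_distrib)

lemma L2_diff:
  fixes X Y :: "'a \<Rightarrow> 'b::{second_countable_topology, real_normed_vector}"
  assumes "subalgebra M G" "X \<in> L2 M G" "Y \<in> L2 M G"
  shows "(\<lambda>\<omega>. X \<omega> - Y \<omega>) \<in> L2 M G"
  using L2_add[OF assms(1,2) L2_scaleR[OF assms(3), of "-1"]] by simp

lemma L2_component:
  fixes X :: "'a \<Rightarrow> real ^ 'd"
  assumes "subalgebra M G" "X \<in> L2 M G"
  shows "(\<lambda>\<omega>. X \<omega> $ j) \<in> L2 M G"
proof -
  note [measurable] = L2_D(1)[OF assms(2)]
  have 1: "(\<lambda>\<omega>. X \<omega> $ j) \<in> borel_measurable G"
    by (rule borel_measurable_continuous_on[where f = "\<lambda>x. x $ j"]) (auto intro: continuous_intros)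
  note [measurable] = measurable_from_subalg[OF assms(1) 1]
  have "(X \<omega> $ j)\<^sup>2 \<le> (norm (X \<omega>))\<^sup>2" for \<omega>
    using component_le_norm_cart[of "X \<omega>" j] by (simp add: abs_le_square_iff[symmetric])
  then have "integrable M (\<lambda>\<omega>. (norm (X \<omega> $ j))\<^sup>2)"
    by (intro Bochner_Integration.integrable_bound[OF L2_D(2)[OF assms(2)]]) auto
  with 1 show ?thesis by (simp add: L2_def)
qed

lemma L2_vecI:
  fixes X :: "'a \<Rightarrow> real ^ 'd"
  assumes "\<And>j. (\<lambda>\<omega>. X \<omega> $ j) \<in> L2 M G"
  shows "X \<in> L2 M G"
proof -
  have "X \<in> borel_measurable G"
    using L2_D(1)[OF assms] by (subst borel_measurable_euclidean_space) (auto simp: Basis_vec_def inner_axis)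
  moreover have "integrable M (\<lambda>\<omega>. (norm (X \<omega>))\<^sup>2)"
    unfolding norm_vec_squared using L2_real_square[OF assms] by simp
  ultimately show ?thesis by (simp add: L2_def)
qed

lemma L2_mult_integrable:
  fixes f g :: "'a \<Rightarrow> real"
  assumes "f \<in> L2 M M" "g \<in> L2 M M"
  shows "integrable M (\<lambda>\<omega>. f \<omega> * g \<omega>)"
proof (rule Bochner_Integration.integrable_bound[of _ "\<lambda>\<omega>. (f \<omega>)\<^sup>2 + (g \<omega>)\<^sup>2"])
  show "integrable M (\<lambda>\<omega>. (f \<omega>)\<^sup>2 + (g \<omega>)\<^sup>2)"
    using assms by (auto simp: L2_real_square)
  show "(\<lambda>\<omega>. f \<omega> * g \<omega>) \<in> borel_measurable M"
    using assms by (auto simp: L2_def)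
  have "\<bar>f \<omega> * g \<omega>\<bar> \<le> (f \<omega>)\<^sup>2 + (g \<omega>)\<^sup>2" for \<omega>
    using sum_squares_bound[of "\<bar>f \<omega>\<bar>" "\<bar>g \<omega>\<bar>"] abs_ge_zero[of "f \<omega> * g \<omega>"]
    unfolding abs_mult power2_abs by linarith
  then show "AE \<omega> in M. norm (f \<omega> * g \<omega>) \<le> norm ((f \<omega>)\<^sup>2 + (g \<omega>)\<^sup>2)"
    by simp
qed

section \<open>Conditional expectations of square-integrable functions\<close>

context finite_measure_subalgebra
begin

lemma L2_const: "(\<lambda>\<omega>. c) \<in> L2 M M"
  by (simp add: L2_def)

lemma L2_integrable: "f \<in> L2 M M \<Longrightarrow> integrable M f" for f :: "'a \<Rightarrow> real"
  using L2_mult_integrable[OF _ L2_const[of 1]] by simp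

text \<open>The quadratic form \<open>q \<mapsto> E[(f + q g)\<^sup>2 | F]\<close> is nonnegative for all rational \<open>q\<close>
  simultaneously outside one null set, hence for all real \<open>q\<close>, and so its discriminant is not
  positive.\<close>

lemma real_cond_exp_Cauchy_Schwarz:
  fixes f g :: "'a \<Rightarrow> real"
  assumes f: "f \<in> L2 M M" and g: "g \<in> L2 M M"
  shows "AE \<omega> in M. (real_cond_exp M F (\<lambda>\<omega>. f \<omega> * g \<omega>) \<omega>)\<^sup>2
    \<le> real_cond_exp M F (\<lambda>\<omega>. (f \<omega>)\<^sup>2) \<omega> * real_cond_exp M F (\<lambda>\<omega>. (g \<omega>)\<^sup>2) \<omega>"
proof -
  let ?a = "real_cond_exp M F (\<lambda>\<omega>. (f \<omega>)\<^sup>2)" and ?b = "real_cond_exp M F (\<lambda>\<omega>. f \<omega> * g \<omega>)"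
    and ?c = "real_cond_exp M F (\<lambda>\<omega>. (g \<omega>)\<^sup>2)"
  note int = L2_real_square[OF f] L2_real_square[OF g] L2_mult_integrable[OF f g]
  note [measurable] = L2_D(1)[OF f] L2_D(1)[OF g]
  have "AE \<omega> in M. 0 \<le> ?a \<omega> + (2 * q) * ?b \<omega> + q\<^sup>2 * ?c \<omega>" for q :: real
  proof -
    have eq: "(f \<omega> + q * g \<omega>)\<^sup>2 = (f \<omega>)\<^sup>2 + (2 * q) * (f \<omega> * g \<omega>) + q\<^sup>2 * (g \<omega>)\<^sup>2" for \<omega>
      by (simp add: power2_eq_square algebra_simps)
    have "AE \<omega> in M. 0 \<le> real_cond_exp M F (\<lambda>\<omega>. (f \<omega> + q * g \<omega>)\<^sup>2) \<omega>"
      by (intro real_cond_exp_pos) auto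
    moreover have "AE \<omega> in M. real_cond_exp M F (\<lambda>\<omega>. (f \<omega> + q * g \<omega>)\<^sup>2) \<omega>
        = real_cond_exp M F (\<lambda>\<omega>. (f \<omega>)\<^sup>2 + (2 * q) * (f \<omega> * g \<omega>)) \<omega>
          + real_cond_exp M F (\<lambda>\<omega>. q\<^sup>2 * (g \<omega>)\<^sup>2) \<omega>"
      unfolding eq by (intro real_cond_exp_add) (use int in auto)
    moreover have "AE \<omega> in M. real_cond_exp M F (\<lambda>\<omega>. (f \<omega>)\<^sup>2 + (2 * q) * (f \<omega> * g \<omega>)) \<omega>
        = ?a \<omega> + real_cond_exp M F (\<lambda>\<omega>. (2 * q) * (f \<omega> * g \<omega>)) \<omega>"
      by (intro real_cond_exp_add) (use int in auto)
    moreover have "AE \<omega> in M. real_cond_exp M F (\<lambda>\<omega>. (2 * q) * (f \<omega> * g \<omega>)) \<omega> = (2 * q) * ?b \<omega>"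
      by (intro real_cond_exp_cmult int)
    moreover have "AE \<omega> in M. real_cond_exp M F (\<lambda>\<omega>. q\<^sup>2 * (g \<omega>)\<^sup>2) \<omega> = q\<^sup>2 * ?c \<omega>"
      by (intro real_cond_exp_cmult int)
    ultimately show ?thesis by eventually_elim simp
  qed
  then have "AE \<omega> in M. \<forall>q\<in>\<rat>. 0 \<le> ?a \<omega> + (2 * q) * ?b \<omega> + q\<^sup>2 * ?c \<omega>"
    by (subst AE_ball_countable) (auto intro: countable_rat)
  moreover have "AE \<omega> in M. 0 \<le> ?c \<omega>"
    by (intro real_cond_exp_pos) auto
  ultimately show ?thesis
  proof eventually_elim
    case (elim \<omega>)
    define a b c where "a = ?a \<omega>" and "b = ?b \<omega>" and "c = ?c \<omega>"
    have c: "0 \<le> c" using elim(2) by (simp add: c_def)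
    have "closure \<rat> \<subseteq> {q. 0 \<le> a + (2 * q) * b + q\<^sup>2 * c}"
      using elim(1) by (intro closure_minimal closed_Collect_le continuous_intros)
        (auto simp: a_def b_def c_def)
    then have q: "0 \<le> a + (2 * q) * b + q\<^sup>2 * c" for q
      by (auto simp: Rats_closure_real)
    have "b\<^sup>2 \<le> a * c"
    proof (cases "c = 0")
      case True
      have "b = 0"
      proof (rule ccontr)
        assume "b \<noteq> 0"
        \<comment> \<open>With \<open>c = 0\<close> the form is affine in \<open>q\<close>, and at
          this point it takes the value -1.\<close>
        then show False using q[of "- (a + 1) / (2 * b)"] True by (simp add: field_simps)
      qed
      with True show ?thesis by simp
    next
      case False
      \<comment> \<open>The minimiser of the form, where its value is
        \<open>a - b\<^sup>2 / c\<close>.\<close>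
      then show ?thesis using q[of "- b / c"] c
        by (simp add: power2_eq_square field_simps)
    qed
    then show ?case by (simp add: a_def b_def c_def)
  qed
qed

lemma real_cond_exp_const: "AE \<omega> in M. real_cond_exp M F (\<lambda>\<omega>. c) \<omega> = c" for c :: real
  by (rule real_cond_exp_F_meas) auto

text \<open>Jensen's inequality for the square, obtained as Cauchy--Schwarz against the constant
  1.\<close>

lemma real_cond_exp_squared_le:
  assumes "f \<in> L2 M M"
  shows "AE \<omega> in M. (real_cond_exp M F f \<omega>)\<^sup>2 \<le> real_cond_exp M F (\<lambda>\<omega>. (f \<omega>)\<^sup>2) \<omega>"
  using real_cond_exp_Cauchy_Schwarz[OF assms L2_const[of 1]] real_cond_exp_const[of 1]
  by eventually_elim simp

lemma L2_AE_bound: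
  fixes X :: "'a \<Rightarrow> 'b::{second_countable_topology, real_normed_vector}"
  assumes "X \<in> borel_measurable F" "integrable M g" "AE \<omega> in M. (norm (X \<omega>))\<^sup>2 \<le> g \<omega>"
  shows "X \<in> L2 M F"
proof -
  note [measurable] = assms(1) measurable_from_subalg[OF subalg assms(1)]
  have "integrable M (\<lambda>\<omega>. (norm (X \<omega>))\<^sup>2)"
    by (rule Bochner_Integration.integrable_bound[OF assms(2)]) (use assms(3) in auto)
  with assms(1) show ?thesis by (simp add: L2_def)
qed

lemma real_cond_exp_L2:
  assumes "f \<in> L2 M M"
  shows "real_cond_exp M F f \<in> L2 M F"
  by (rule L2_AE_bound[OF _ real_cond_exp_int(1)[OF L2_real_square[OF assms]]])
     (use real_cond_exp_squared_le[OF assms] in auto)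

lemma vec_cond_exp_nth: "vec_cond_exp M F X \<omega> $ j = real_cond_exp M F (\<lambda>\<omega>'. X \<omega>' $ j) \<omega>"
  by (simp add: vec_cond_exp_def)

lemma vec_cond_exp_L2:
  assumes "X \<in> L2 M M"
  shows "vec_cond_exp M F X \<in> L2 M F"
  by (rule L2_vecI) (simp add: vec_cond_exp_nth real_cond_exp_L2 L2_component assms subalgebra_refl)

lemma integral_square_real_cond_exp_le:
  assumes "f \<in> L2 M M"
  shows "(\<integral>\<omega>. (real_cond_exp M F f \<omega>)\<^sup>2 \<partial>M) \<le> (\<integral>\<omega>. (f \<omega>)\<^sup>2 \<partial>M)"
proof -
  have "(\<integral>\<omega>. (real_cond_exp M F f \<omega>)\<^sup>2 \<partial>M) \<le> (\<integral>\<omega>. real_cond_exp M F (\<lambda>\<omega>. (f \<omega>)\<^sup>2) \<omega> \<partial>M)"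
    using real_cond_exp_L2[OF assms] L2_real_square[OF assms] real_cond_exp_squared_le[OF assms]
    by (intro integral_mono_AE) (auto simp: L2_real_square)
  also have "\<dots> = (\<integral>\<omega>. (f \<omega>)\<^sup>2 \<partial>M)"
    by (rule real_cond_exp_int(2)[OF L2_real_square[OF assms]])
  finally show ?thesis .
qed

lemma integral_square_vec_cond_exp_le:
  assumes X: "X \<in> L2 M M"
  shows "(\<integral>\<omega>. (norm (vec_cond_exp M F X \<omega>))\<^sup>2 \<partial>M) \<le> (\<integral>\<omega>. (norm (X \<omega>))\<^sup>2 \<partial>M)"
proof -
  note c = L2_component[OF subalgebra_refl X]
  have "(\<integral>\<omega>. (norm (vec_cond_exp M F X \<omega>))\<^sup>2 \<partial>M)
      = (\<Sum>j\<in>UNIV. \<integral>\<omega>. (real_cond_exp M F (\<lambda>\<omega>. X \<omega> $ j) \<omega>)\<^sup>2 \<partial>M)"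
    unfolding norm_vec_squared vec_cond_exp_nth
    by (intro Bochner_Integration.integral_sum L2_real_square[OF real_cond_exp_L2[OF c]])
  also have "\<dots> \<le> (\<Sum>j\<in>UNIV. \<integral>\<omega>. (X \<omega> $ j)\<^sup>2 \<partial>M)"
    by (intro sum_mono integral_square_real_cond_exp_le c)
  also have "\<dots> = (\<integral>\<omega>. (norm (X \<omega>))\<^sup>2 \<partial>M)"
    unfolding norm_vec_squared
    by (intro Bochner_Integration.integral_sum[symmetric] L2_real_square[OF c])
  finally show ?thesis .
qed

text \<open>The exceptional null sets of the finitely many components are united. Only integrability
  of the components is assumed, because the rule is applied to products of a scalar error with the
  weight, which need not be square-integrable.\<close>

lemma vec_cond_exp_diff:
  assumes "\<And>j. integrable M (\<lambda>\<omega>. X \<omega> $ j)" "\<And>j. integrable M (\<lambda>\<omega>. Y \<omega> $ j)"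
  shows "AE \<omega> in M. vec_cond_exp M F (\<lambda>\<omega>. X \<omega> - Y \<omega>) \<omega> = vec_cond_exp M F X \<omega> - vec_cond_exp M F Y \<omega>"
proof -
  have "AE \<omega> in M. \<forall>j. vec_cond_exp M F (\<lambda>\<omega>. X \<omega> - Y \<omega>) \<omega> $ j
      = vec_cond_exp M F X \<omega> $ j - vec_cond_exp M F Y \<omega> $ j"
    unfolding AE_all_countable vec_cond_exp_nth using real_cond_exp_diff[OF assms] by simp
  then show ?thesis by (simp add: vec_eq_iff)
qed

lemma vec_cond_exp_add:
  assumes "\<And>j. integrable M (\<lambda>\<omega>. X \<omega> $ j)" "\<And>j. integrable M (\<lambda>\<omega>. Y \<omega> $ j)"
  shows "AE \<omega> in M. vec_cond_exp M F (\<lambda>\<omega>. X \<omega> + Y \<omega>) \<omega> = vec_cond_exp M F X \<omega> + vec_cond_exp M F Y \<omega>"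
proof -
  have "AE \<omega> in M. \<forall>j. vec_cond_exp M F (\<lambda>\<omega>. X \<omega> + Y \<omega>) \<omega> $ j
      = vec_cond_exp M F X \<omega> $ j + vec_cond_exp M F Y \<omega> $ j"
    unfolding AE_all_countable vec_cond_exp_nth using real_cond_exp_add[OF assms] by simp
  then show ?thesis by (simp add: vec_eq_iff)
qed

lemma vec_cond_exp_scaleR:
  assumes "\<And>j. integrable M (\<lambda>\<omega>. X \<omega> $ j)"
  shows "AE \<omega> in M. vec_cond_exp M F (\<lambda>\<omega>. c *\<^sub>R X \<omega>) \<omega> = c *\<^sub>R vec_cond_exp M F X \<omega>"
proof -
  have "AE \<omega> in M. \<forall>j. vec_cond_exp M F (\<lambda>\<omega>. c *\<^sub>R X \<omega>) \<omega> $ j = c * vec_cond_exp M F X \<omega> $ j"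
    unfolding AE_all_countable vec_cond_exp_nth using real_cond_exp_cmult[OF assms] by simp
  then show ?thesis by (simp add: vec_eq_iff)
qed

section \<open>Conditional variance\<close>

text \<open>The uncentred form is the one that occurs in \<open>increment_bound\<close>;
  \<open>real_cond_exp_centred_square\<close> identifies it with the centred one.\<close>

definition cond_var :: "('a \<Rightarrow> real) \<Rightarrow> 'a \<Rightarrow> real" where
  "cond_var f \<omega> = real_cond_exp M F (\<lambda>\<omega>. (f \<omega>)\<^sup>2) \<omega> - (real_cond_exp M F f \<omega>)\<^sup>2"

lemma cond_var_integrable:
  assumes "f \<in> L2 M M"
  shows "integrable M (cond_var f)"
  unfolding cond_var_def
  using real_cond_exp_int(1)[OF L2_real_square[OF assms]] L2_real_square[OF real_cond_exp_L2[OF assms]]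
  by simp

text \<open>This identity turns the second moment of a conditional mean into the full second moment
  minus the expected conditional variance, which is the gain that the stability argument lives
  on.\<close>

lemma integral_cond_var:
  assumes "f \<in> L2 M M"
  shows "(\<integral>\<omega>. cond_var f \<omega> \<partial>M) = (\<integral>\<omega>. (f \<omega>)\<^sup>2 \<partial>M) - (\<integral>\<omega>. (real_cond_exp M F f \<omega>)\<^sup>2 \<partial>M)"
  unfolding cond_var_def
  using real_cond_exp_int[OF L2_real_square[OF assms]] L2_real_square[OF real_cond_exp_L2[OF assms]]
  by simp

lemma integral_cond_var_nonneg: "f \<in> L2 M M \<Longrightarrow> 0 \<le> (\<integral>\<omega>. cond_var f \<omega> \<partial>M)"
  using integral_square_real_cond_exp_le by (simp add: integral_cond_var)

text \<open>The conditional mean is \<open>F\<close>-measurable and can be pulled out of the mixed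
  term of the expanded square, which thereby becomes minus twice the squared conditional
  mean.\<close>

lemma real_cond_exp_centred_square:
  assumes f: "f \<in> L2 M M"
  shows "AE \<omega> in M. real_cond_exp M F (\<lambda>\<omega>. (f \<omega> - real_cond_exp M F f \<omega>)\<^sup>2) \<omega> = cond_var f \<omega>"
proof -
  let ?e = "real_cond_exp M F f"
  have eF: "?e \<in> L2 M F" by (rule real_cond_exp_L2[OF f])
  then have e: "?e \<in> L2 M M" by (rule L2_subalgebra[OF subalg])
  have int: "integrable M (\<lambda>\<omega>. (f \<omega>)\<^sup>2)" "integrable M (\<lambda>\<omega>. (?e \<omega>)\<^sup>2)" "integrable M (\<lambda>\<omega>. ?e \<omega> * f \<omega>)"
    using f e by (auto simp: L2_real_square L2_mult_integrable)
  have eq: "(f \<omega> - ?e \<omega>)\<^sup>2 = ((f \<omega>)\<^sup>2 - 2 * (?e \<omega> * f \<omega>)) + (?e \<omega>)\<^sup>2" for \<omega>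
    by (simp add: power2_eq_square algebra_simps)
  have "AE \<omega> in M. real_cond_exp M F (\<lambda>\<omega>. (f \<omega> - ?e \<omega>)\<^sup>2) \<omega>
      = real_cond_exp M F (\<lambda>\<omega>. (f \<omega>)\<^sup>2 - 2 * (?e \<omega> * f \<omega>)) \<omega> + real_cond_exp M F (\<lambda>\<omega>. (?e \<omega>)\<^sup>2) \<omega>"
    unfolding eq using int by (intro real_cond_exp_add) auto
  moreover have "AE \<omega> in M. real_cond_exp M F (\<lambda>\<omega>. (f \<omega>)\<^sup>2 - 2 * (?e \<omega> * f \<omega>)) \<omega>
      = real_cond_exp M F (\<lambda>\<omega>. (f \<omega>)\<^sup>2) \<omega> - real_cond_exp M F (\<lambda>\<omega>. 2 * (?e \<omega> * f \<omega>)) \<omega>"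
    using int by (intro real_cond_exp_diff) auto
  moreover have "AE \<omega> in M. real_cond_exp M F (\<lambda>\<omega>. 2 * (?e \<omega> * f \<omega>)) \<omega>
      = 2 * real_cond_exp M F (\<lambda>\<omega>. ?e \<omega> * f \<omega>) \<omega>"
    using int by (intro real_cond_exp_cmult)
  moreover have "AE \<omega> in M. real_cond_exp M F (\<lambda>\<omega>. ?e \<omega> * f \<omega>) \<omega> = ?e \<omega> * ?e \<omega>"
    using int f by (intro real_cond_exp_mult) (auto simp: L2_def)
  moreover have "AE \<omega> in M. real_cond_exp M F (\<lambda>\<omega>. (?e \<omega>)\<^sup>2) \<omega> = (?e \<omega>)\<^sup>2"
    using int by (intro real_cond_exp_F_meas) auto
  ultimately show ?thesis
    by eventually_elim (simp add: cond_var_def power2_eq_square)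
qed

text \<open>A weight with vanishing conditional mean does not see the conditional mean of \<open>f\<close>.\<close>

lemma weighted_cond_exp_bound:
  fixes H :: "'a \<Rightarrow> real ^ 'd"
  assumes H: "H \<in> L2 M M" and f: "f \<in> L2 M M" and h: "0 < h"
    and mean: "AE \<omega> in M. vec_cond_exp M F H \<omega> = 0"
    and var: "AE \<omega> in M. real_cond_exp M F (\<lambda>\<omega>. h * (norm (H \<omega>))\<^sup>2) \<omega> \<le> \<Lambda>"
  shows "AE \<omega> in M. (norm (vec_cond_exp M F (\<lambda>\<omega>. f \<omega> *\<^sub>R H \<omega>) \<omega>))\<^sup>2 \<le> \<Lambda> / h * cond_var f \<omega>"
proof -
  let ?e = "real_cond_exp M F f"
  let ?D = "\<lambda>\<omega>. f \<omega> - ?e \<omega>"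
  have e: "?e \<in> L2 M M" by (rule L2_subalgebra[OF subalg real_cond_exp_L2[OF f]])
  have D: "?D \<in> L2 M M" by (rule L2_diff[OF subalgebra_refl f e])
  have Hj: "(\<lambda>\<omega>. H \<omega> $ j) \<in> L2 M M" for j by (rule L2_component[OF subalgebra_refl H])
  \<comment> \<open>Cauchy--Schwarz is applied to the centred \<open>?D\<close> in place of
    \<open>f\<close>. The left side does not change, because \<open>?e\<close> can be pulled out of
    its product with the component of \<open>H\<close>, whose conditional mean vanishes.\<close>
  have "AE \<omega> in M. (real_cond_exp M F (\<lambda>\<omega>. f \<omega> * H \<omega> $ j) \<omega>)\<^sup>2
      \<le> cond_var f \<omega> * real_cond_exp M F (\<lambda>\<omega>. (H \<omega> $ j)\<^sup>2) \<omega>" for j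
  proof -
    have "AE \<omega> in M. real_cond_exp M F (\<lambda>\<omega>. f \<omega> * H \<omega> $ j - ?e \<omega> * H \<omega> $ j) \<omega>
        = real_cond_exp M F (\<lambda>\<omega>. f \<omega> * H \<omega> $ j) \<omega> - real_cond_exp M F (\<lambda>\<omega>. ?e \<omega> * H \<omega> $ j) \<omega>"
      by (intro real_cond_exp_diff L2_mult_integrable f e Hj)
    moreover have "AE \<omega> in M. real_cond_exp M F (\<lambda>\<omega>. ?e \<omega> * H \<omega> $ j) \<omega>
        = ?e \<omega> * real_cond_exp M F (\<lambda>\<omega>. H \<omega> $ j) \<omega>"
      by (intro real_cond_exp_mult L2_mult_integrable e Hj L2_D(1)[OF Hj]) auto
    moreover have "AE \<omega> in M. real_cond_exp M F (\<lambda>\<omega>. H \<omega> $ j) \<omega> = 0"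
      using mean by eventually_elim (metis vec_cond_exp_nth zero_index)
    ultimately show ?thesis
      using real_cond_exp_Cauchy_Schwarz[OF D Hj[of j]] real_cond_exp_centred_square[OF f]
      by eventually_elim (simp add: left_diff_distrib)
  qed
  then have "AE \<omega> in M. \<forall>j. (real_cond_exp M F (\<lambda>\<omega>. f \<omega> * H \<omega> $ j) \<omega>)\<^sup>2
      \<le> cond_var f \<omega> * real_cond_exp M F (\<lambda>\<omega>. (H \<omega> $ j)\<^sup>2) \<omega>"
    by (simp add: AE_all_countable)
  moreover have "AE \<omega> in M. real_cond_exp M F (\<lambda>\<omega>. \<Sum>j\<in>UNIV. (H \<omega> $ j)\<^sup>2) \<omega>
      = (\<Sum>j\<in>UNIV. real_cond_exp M F (\<lambda>\<omega>. (H \<omega> $ j)\<^sup>2) \<omega>)"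
    by (rule real_cond_exp_sum) (rule L2_real_square[OF Hj])
  moreover have "AE \<omega> in M. real_cond_exp M F (\<lambda>\<omega>. h * (norm (H \<omega>))\<^sup>2) \<omega>
      = h * real_cond_exp M F (\<lambda>\<omega>. (norm (H \<omega>))\<^sup>2) \<omega>"
    by (intro real_cond_exp_cmult L2_D(2)[OF H])
  moreover have "AE \<omega> in M. 0 \<le> cond_var f \<omega>"
    using real_cond_exp_squared_le[OF f] by eventually_elim (simp add: cond_var_def)
  ultimately show ?thesis using var
  proof eventually_elim
    case (elim \<omega>)
    have "(norm (vec_cond_exp M F (\<lambda>\<omega>. f \<omega> *\<^sub>R H \<omega>) \<omega>))\<^sup>2
        = (\<Sum>j\<in>UNIV. (real_cond_exp M F (\<lambda>\<omega>. f \<omega> * H \<omega> $ j) \<omega>)\<^sup>2)"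
      by (simp add: norm_vec_squared vec_cond_exp_nth)
    also have "\<dots> \<le> (\<Sum>j\<in>UNIV. cond_var f \<omega> * real_cond_exp M F (\<lambda>\<omega>. (H \<omega> $ j)\<^sup>2) \<omega>)"
      using elim(1) by (intro sum_mono) auto
    also have "\<dots> = cond_var f \<omega> * real_cond_exp M F (\<lambda>\<omega>. (norm (H \<omega>))\<^sup>2) \<omega>"
      using elim(2) by (simp add: sum_distrib_left norm_vec_squared)
    \<comment> \<open>The bound \<open>var\<close> is conditional, so it can be multiplied pointwise
      by the random nonnegative factor \<open>cond_var f\<close>.\<close>
    also have "\<dots> \<le> cond_var f \<omega> * (\<Lambda> / h)"
      using elim(3-5) h by (intro mult_left_mono) (auto simp: field_simps)
    finally show ?case by (simp add: mult.commute)
  qed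
qed

text \<open>Measurability is assumed of \<open>X\<close> itself, since a modification on a null set
  need not be \<open>F\<close>-measurable.\<close>

lemma L2_AE_eq:
  fixes X Y :: "'a \<Rightarrow> 'b::{second_countable_topology, real_normed_vector}"
  assumes "X \<in> borel_measurable F" "Y \<in> L2 M F" "AE \<omega> in M. X \<omega> = Y \<omega>"
  shows "X \<in> L2 M F"
  by (rule L2_AE_bound[OF assms(1) L2_D(2)[OF assms(2)]]) (use assms(3) in auto)

lemma borel_measurable_vec_cond_exp: "vec_cond_exp M F X \<in> borel_measurable F"
  unfolding vec_cond_exp_def
  by (subst borel_measurable_euclidean_space) (auto simp: Basis_vec_def inner_axis)

lemma L2_mult_component_integrable:
  fixes H :: "'a \<Rightarrow> real ^ 'd"
  assumes "H \<in> L2 M M" "f \<in> L2 M M"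
  shows "integrable M (\<lambda>\<omega>. (f \<omega> *\<^sub>R H \<omega>) $ j)"
  using L2_mult_integrable[OF assms(2) L2_component[OF subalgebra_refl assms(1)]] by simp

text \<open>The product of \<open>f\<close> and \<open>H\<close> is in general only integrable, so
  \<open>vec_cond_exp_L2\<close> does not apply to it; the bound by the integrable function
  \<open>cond_var f\<close> replaces that argument.\<close>

lemma weighted_cond_exp_L2:
  fixes H :: "'a \<Rightarrow> real ^ 'd"
  assumes H: "H \<in> L2 M M" and f: "f \<in> L2 M M" and h: "0 < h"
    and mean: "AE \<omega> in M. vec_cond_exp M F H \<omega> = 0"
    and var: "AE \<omega> in M. real_cond_exp M F (\<lambda>\<omega>. h * (norm (H \<omega>))\<^sup>2) \<omega> \<le> \<Lambda>"
  shows "vec_cond_exp M F (\<lambda>\<omega>. f \<omega> *\<^sub>R H \<omega>) \<in> L2 M F"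
  by (rule L2_AE_bound[OF borel_measurable_vec_cond_exp _ weighted_cond_exp_bound[OF assms]])
     (simp add: cond_var_integrable f)

lemma L2_integrable_component:
  fixes X :: "'a \<Rightarrow> real ^ 'd"
  shows "X \<in> L2 M M \<Longrightarrow> integrable M (\<lambda>\<omega>. X \<omega> $ j)"
  using L2_integrable[OF L2_component[OF subalgebra_refl]] by blast

section \<open>Error estimates over one step\<close>

text \<open>Young's inequality separates the conditional mean of \<open>D\<close> from the
  remainder. The second moment of that mean is kept exactly instead of being bounded by the second
  moment of \<open>D\<close>, and this leaves the conditional variance with a negative sign.\<close>

lemma real_step_estimate:
  fixes y D P \<zeta> :: "'a \<Rightarrow> real"
  assumes D: "D \<in> L2 M M" and P: "P \<in> L2 M M" and \<zeta>: "\<zeta> \<in> L2 M M"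
    and y: "y \<in> L2 M M"
    and eq: "AE \<omega> in M. y \<omega>
      = real_cond_exp M F D \<omega> + (h * real_cond_exp M F P \<omega> - real_cond_exp M F \<zeta> \<omega>)"
    and \<theta>: "0 < \<theta>"
  shows "(\<integral>\<omega>. (y \<omega>)\<^sup>2 \<partial>M)
    \<le> (1 + \<theta>) * ((\<integral>\<omega>. (D \<omega>)\<^sup>2 \<partial>M) - (\<integral>\<omega>. cond_var D \<omega> \<partial>M))
      + 2 * (1 + 1 / \<theta>) * (h\<^sup>2 * (\<integral>\<omega>. (P \<omega>)\<^sup>2 \<partial>M) + (\<integral>\<omega>. (real_cond_exp M F \<zeta> \<omega>)\<^sup>2 \<partial>M))"
proof -
  note int = L2_real_square[OF real_cond_exp_L2[OF D]] L2_real_square[OF real_cond_exp_L2[OF P]]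
    L2_real_square[OF real_cond_exp_L2[OF \<zeta>]]
  let ?B = "\<lambda>\<omega>. (1 + \<theta>) * (real_cond_exp M F D \<omega>)\<^sup>2
      + 2 * (1 + 1 / \<theta>) * (h\<^sup>2 * (real_cond_exp M F P \<omega>)\<^sup>2 + (real_cond_exp M F \<zeta> \<omega>)\<^sup>2)"
  have "(\<integral>\<omega>. (y \<omega>)\<^sup>2 \<partial>M) \<le> (\<integral>\<omega>. ?B \<omega> \<partial>M)"
  proof (intro integral_mono_AE)
    show "AE \<omega> in M. (y \<omega>)\<^sup>2 \<le> ?B \<omega>"
      using eq
    proof eventually_elim
      case (elim \<omega>)
      let ?p = "h * real_cond_exp M F P \<omega>" and ?q = "real_cond_exp M F \<zeta> \<omega>"
      have "(y \<omega>)\<^sup>2 \<le> (1 + \<theta>) * (real_cond_exp M F D \<omega>)\<^sup>2 + (1 + 1 / \<theta>) * (?p - ?q)\<^sup>2"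
        using weighted_square_add_le[OF \<theta>] elim by simp
      also have "(1 + 1 / \<theta>) * (?p - ?q)\<^sup>2 \<le> (1 + 1 / \<theta>) * (2 * ?p\<^sup>2 + 2 * ?q\<^sup>2)"
        using norm_diff_squared_le[of ?p ?q] \<theta> by (intro mult_left_mono) auto
      finally show ?case by (simp add: power_mult_distrib algebra_simps)
    qed
  qed (use int L2_real_square[OF y] in auto)
  also have "\<dots> = (1 + \<theta>) * (\<integral>\<omega>. (real_cond_exp M F D \<omega>)\<^sup>2 \<partial>M)
      + 2 * (1 + 1 / \<theta>) * (h\<^sup>2 * (\<integral>\<omega>. (real_cond_exp M F P \<omega>)\<^sup>2 \<partial>M)
      + (\<integral>\<omega>. (real_cond_exp M F \<zeta> \<omega>)\<^sup>2 \<partial>M))"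
    using int by simp
  \<comment> \<open>Only the generator term is estimated by the contraction property; the
    perturbation stays projected, as it is measured in \<open>L2_stable\<close>.\<close>
  also have "\<dots> \<le> (1 + \<theta>) * (\<integral>\<omega>. (real_cond_exp M F D \<omega>)\<^sup>2 \<partial>M)
      + 2 * (1 + 1 / \<theta>) * (h\<^sup>2 * (\<integral>\<omega>. (P \<omega>)\<^sup>2 \<partial>M)
      + (\<integral>\<omega>. (real_cond_exp M F \<zeta> \<omega>)\<^sup>2 \<partial>M))"
    using \<theta> integral_square_real_cond_exp_le[OF P]
    by (intro add_left_mono mult_left_mono add_right_mono) auto
  finally show ?thesis by (simp add: integral_cond_var[OF D])
qed

text \<open>A crude split into three terms suffices, because this estimate later enters only with
  the small factor \<open>c\<close>, which absorbs the 3. The term with the weight is controlled by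
  the conditional variance alone.\<close>

lemma vec_step_estimate:
  fixes z H P \<zeta> :: "'a \<Rightarrow> real ^ 'd"
  assumes D: "D \<in> L2 M M" and P: "P \<in> L2 M M" and \<zeta>: "\<zeta> \<in> L2 M M" and z: "z \<in> L2 M M"
    and H: "H \<in> L2 M M" and h: "0 < h"
    and mean: "AE \<omega> in M. vec_cond_exp M F H \<omega> = 0"
    and var: "AE \<omega> in M. real_cond_exp M F (\<lambda>\<omega>. h * (norm (H \<omega>))\<^sup>2) \<omega> \<le> \<Lambda>"
    and eq: "AE \<omega> in M. z \<omega> = vec_cond_exp M F (\<lambda>\<omega>. D \<omega> *\<^sub>R H \<omega>) \<omega>
      + h *\<^sub>R vec_cond_exp M F P \<omega> - vec_cond_exp M F \<zeta> \<omega>"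
  shows "(\<integral>\<omega>. (norm (z \<omega>))\<^sup>2 \<partial>M)
    \<le> 3 * (\<Lambda> / h * (\<integral>\<omega>. cond_var D \<omega> \<partial>M) + h\<^sup>2 * (\<integral>\<omega>. (norm (P \<omega>))\<^sup>2 \<partial>M)
        + (\<integral>\<omega>. (norm (vec_cond_exp M F \<zeta> \<omega>))\<^sup>2 \<partial>M))"
proof -
  note int = cond_var_integrable[OF D] L2_D(2)[OF vec_cond_exp_L2[OF P]]
    L2_D(2)[OF vec_cond_exp_L2[OF \<zeta>]]
  let ?B = "\<lambda>\<omega>. 3 * (\<Lambda> / h * cond_var D \<omega> + h\<^sup>2 * (norm (vec_cond_exp M F P \<omega>))\<^sup>2
      + (norm (vec_cond_exp M F \<zeta> \<omega>))\<^sup>2)"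
  have "(\<integral>\<omega>. (norm (z \<omega>))\<^sup>2 \<partial>M) \<le> (\<integral>\<omega>. ?B \<omega> \<partial>M)"
  proof (intro integral_mono_AE)
    show "AE \<omega> in M. (norm (z \<omega>))\<^sup>2 \<le> ?B \<omega>"
      using eq weighted_cond_exp_bound[OF H D h mean var]
    proof eventually_elim
      case (elim \<omega>)
      then show ?case
        using norm_add_add_squared_le[of "vec_cond_exp M F (\<lambda>\<omega>. D \<omega> *\<^sub>R H \<omega>) \<omega>"
            "h *\<^sub>R vec_cond_exp M F P \<omega>" "- vec_cond_exp M F \<zeta> \<omega>"]
        by (simp add: power_mult_distrib)
    qed
  qed (use int L2_D(2)[OF z] in auto)
  also have "\<dots> = 3 * (\<Lambda> / h * (\<integral>\<omega>. cond_var D \<omega> \<partial>M)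
      + h\<^sup>2 * (\<integral>\<omega>. (norm (vec_cond_exp M F P \<omega>))\<^sup>2 \<partial>M)
      + (\<integral>\<omega>. (norm (vec_cond_exp M F \<zeta> \<omega>))\<^sup>2 \<partial>M))"
    using int by simp
  also have "\<dots> \<le> 3 * (\<Lambda> / h * (\<integral>\<omega>. cond_var D \<omega> \<partial>M) + h\<^sup>2 * (\<integral>\<omega>. (norm (P \<omega>))\<^sup>2 \<partial>M)
        + (\<integral>\<omega>. (norm (vec_cond_exp M F \<zeta> \<omega>))\<^sup>2 \<partial>M))"
    using integral_square_vec_cond_exp_le[OF P]
    by (intro mult_left_mono add_left_mono add_right_mono) auto
  finally show ?thesis .
qed

text \<open>Linearity of the conditional expectation. The summand \<open>0\<close> is the zero
  perturbation through which \<open>scheme_solution\<close> is expressed by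
  \<open>perturbed_solution\<close>.\<close>

lemma real_scheme_difference:
  fixes U U' P P' \<zeta> :: "'a \<Rightarrow> real"
  assumes L2: "U \<in> L2 M M" "U' \<in> L2 M M" "P \<in> L2 M M" "P' \<in> L2 M M" "\<zeta> \<in> L2 M M"
    and "AE \<omega> in M. y \<omega> = real_cond_exp M F (\<lambda>\<omega>. U \<omega> + h * P \<omega> + 0) \<omega>"
    and "AE \<omega> in M. y' \<omega> = real_cond_exp M F (\<lambda>\<omega>. U' \<omega> + h * P' \<omega> + \<zeta> \<omega>) \<omega>"
  shows "AE \<omega> in M. y \<omega> - y' \<omega> = real_cond_exp M F (\<lambda>\<omega>. U \<omega> - U' \<omega>) \<omega>
    + (h * real_cond_exp M F (\<lambda>\<omega>. P \<omega> - P' \<omega>) \<omega> - real_cond_exp M F \<zeta> \<omega>)"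
proof -
  note int = L2[THEN L2_integrable]
  have "AE \<omega> in M. real_cond_exp M F (\<lambda>\<omega>. U \<omega> + h * P \<omega>) \<omega>
      = real_cond_exp M F U \<omega> + real_cond_exp M F (\<lambda>\<omega>. h * P \<omega>) \<omega>"
    using int by (intro real_cond_exp_add) auto
  moreover have "AE \<omega> in M. real_cond_exp M F (\<lambda>\<omega>. U' \<omega> + h * P' \<omega> + \<zeta> \<omega>) \<omega>
      = real_cond_exp M F (\<lambda>\<omega>. U' \<omega> + h * P' \<omega>) \<omega> + real_cond_exp M F \<zeta> \<omega>"
    using int by (intro real_cond_exp_add) auto
  moreover have "AE \<omega> in M. real_cond_exp M F (\<lambda>\<omega>. U' \<omega> + h * P' \<omega>) \<omega>
      = real_cond_exp M F U' \<omega> + real_cond_exp M F (\<lambda>\<omega>. h * P' \<omega>) \<omega>"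
    using int by (intro real_cond_exp_add) auto
  ultimately show ?thesis
    using assms(6,7) real_cond_exp_cmult[OF int(3), of h] real_cond_exp_cmult[OF int(4), of h]
      real_cond_exp_diff[OF int(1,2)] real_cond_exp_diff[OF int(3,4)]
    by eventually_elim (simp add: right_diff_distrib)
qed

lemma vec_scheme_difference:
  fixes H P P' \<zeta> :: "'a \<Rightarrow> real ^ 'd"
  assumes L2: "U \<in> L2 M M" "U' \<in> L2 M M" "P \<in> L2 M M" "P' \<in> L2 M M" "\<zeta> \<in> L2 M M" "H \<in> L2 M M"
    and "AE \<omega> in M. z \<omega> = vec_cond_exp M F (\<lambda>\<omega>. U \<omega> *\<^sub>R H \<omega> + h *\<^sub>R P \<omega> + 0) \<omega>"
    and "AE \<omega> in M. z' \<omega> = vec_cond_exp M F (\<lambda>\<omega>. U' \<omega> *\<^sub>R H \<omega> + h *\<^sub>R P' \<omega> + \<zeta> \<omega>) \<omega>"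
  shows "AE \<omega> in M. z \<omega> - z' \<omega> = vec_cond_exp M F (\<lambda>\<omega>. (U \<omega> - U' \<omega>) *\<^sub>R H \<omega>) \<omega>
    + h *\<^sub>R vec_cond_exp M F (\<lambda>\<omega>. P \<omega> - P' \<omega>) \<omega> - vec_cond_exp M F \<zeta> \<omega>"
proof -
  note int = L2(3-5)[THEN L2_integrable_component] L2(1,2)[THEN L2_mult_component_integrable[OF L2(6)]]
  have hint: "integrable M (\<lambda>\<omega>. (h *\<^sub>R P \<omega>) $ j)" "integrable M (\<lambda>\<omega>. (h *\<^sub>R P' \<omega>) $ j)" for j
    using int by auto
  have "integrable M (\<lambda>\<omega>. (U' \<omega> *\<^sub>R H \<omega> + h *\<^sub>R P' \<omega>) $ j)" for j
    using int(5)[of j] hint(2)[of j] by (simp only: vector_add_component Bochner_Integration.integrable_add)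
  from vec_cond_exp_add[OF this int(3)] vec_cond_exp_add[OF int(4) hint(1)] vec_cond_exp_add[OF int(5) hint(2)]
    vec_cond_exp_scaleR[OF int(1), of h] vec_cond_exp_scaleR[OF int(2), of h]
    vec_cond_exp_diff[OF int(4,5)] vec_cond_exp_diff[OF int(1,2)] assms(7,8)
  show ?thesis
    by eventually_elim (simp add: scaleR_diff_left scaleR_diff_right)
qed

lemma scheme_step_L2:
  fixes H P \<zeta>Z :: "'a \<Rightarrow> real ^ 'd"
  assumes U: "U \<in> L2 M M" and Q: "Q \<in> L2 M M" and P: "P \<in> L2 M M"
    and \<zeta>: "\<zeta>Y \<in> L2 M M" "\<zeta>Z \<in> L2 M M"
    and H: "H \<in> L2 M M" and h: "0 < h"
    and mean: "AE \<omega> in M. vec_cond_exp M F H \<omega> = 0"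
    and var: "AE \<omega> in M. real_cond_exp M F (\<lambda>\<omega>. h * (norm (H \<omega>))\<^sup>2) \<omega> \<le> \<Lambda>"
    and meas: "y \<in> borel_measurable F" "z \<in> borel_measurable F"
    and y: "AE \<omega> in M. y \<omega> = real_cond_exp M F (\<lambda>\<omega>. U \<omega> + h * Q \<omega> + \<zeta>Y \<omega>) \<omega>"
    and z: "AE \<omega> in M. z \<omega> = vec_cond_exp M F (\<lambda>\<omega>. U \<omega> *\<^sub>R H \<omega> + h *\<^sub>R P \<omega> + \<zeta>Z \<omega>) \<omega>"
  shows "y \<in> L2 M F" "z \<in> L2 M F"
proof -
  have "(\<lambda>\<omega>. U \<omega> + h * Q \<omega> + \<zeta>Y \<omega>) \<in> L2 M M"
    using L2_add[OF subalgebra_refl L2_add[OF subalgebra_refl U L2_scaleR[OF Q, of h]] \<zeta>(1)] by simp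
  from L2_AE_eq[OF meas(1) real_cond_exp_L2[OF this] y] show "y \<in> L2 M F" .
  have R: "(\<lambda>\<omega>. h *\<^sub>R P \<omega> + \<zeta>Z \<omega>) \<in> L2 M M"
    by (intro L2_add L2_scaleR subalgebra_refl P \<zeta>)
  \<comment> \<open>The product with \<open>H\<close> is split off, because only the remaining
    summands are known to be square-integrable before conditioning.\<close>
  have "(\<lambda>\<omega>. vec_cond_exp M F (\<lambda>\<omega>. U \<omega> *\<^sub>R H \<omega>) \<omega> + vec_cond_exp M F (\<lambda>\<omega>. h *\<^sub>R P \<omega> + \<zeta>Z \<omega>) \<omega>)
      \<in> L2 M F"
    by (intro L2_add subalg weighted_cond_exp_L2[OF H U h mean var] vec_cond_exp_L2 R)
  moreover have "AE \<omega> in M. z \<omega> = vec_cond_exp M F (\<lambda>\<omega>. U \<omega> *\<^sub>R H \<omega>) \<omega>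
      + vec_cond_exp M F (\<lambda>\<omega>. h *\<^sub>R P \<omega> + \<zeta>Z \<omega>) \<omega>"
    using z vec_cond_exp_add[OF L2_mult_component_integrable[OF H U] L2_integrable_component[OF R]]
    by eventually_elim (simp add: add.assoc)
  ultimately show "z \<in> L2 M F"
    by (rule L2_AE_eq[OF meas(2)])
qed

text \<open>Integration removes the conditioning on both sides, except inside the conditional
  variance. Here \<open>g\<close> is the squared increment of a generator, and \<open>k\<close> is
  \<open>K\<close> for the first generator and \<open>K / h\<close> for the second.\<close>

lemma integral_le_increment_bound:
  assumes g: "integrable M g" and U: "(\<lambda>\<omega>. U \<omega> - U' \<omega>) \<in> L2 M M" and V: "(\<lambda>\<omega>. V \<omega> - V' \<omega>) \<in> L2 M M"
    and le: "AE \<omega> in M. real_cond_exp M F g \<omega> \<le> k * increment_bound M F h U U' V V' \<omega>"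
  shows "(\<integral>\<omega>. g \<omega> \<partial>M) \<le> k * ((\<integral>\<omega>. cond_var (\<lambda>\<omega>. U \<omega> - U' \<omega>) \<omega> \<partial>M) / h
    + (\<integral>\<omega>. (U \<omega> - U' \<omega>)\<^sup>2 \<partial>M) + (\<integral>\<omega>. (norm (V \<omega> - V' \<omega>))\<^sup>2 \<partial>M))"
proof -
  have int: "integrable M (\<lambda>\<omega>. (U \<omega> - U' \<omega>)\<^sup>2 + (norm (V \<omega> - V' \<omega>))\<^sup>2)"
    using L2_real_square[OF U] L2_D(2)[OF V] by simp
  have eq: "increment_bound M F h U U' V V' = (\<lambda>\<omega>. 1 / h * cond_var (\<lambda>\<omega>. U \<omega> - U' \<omega>) \<omega>
      + real_cond_exp M F (\<lambda>\<omega>. (U \<omega> - U' \<omega>)\<^sup>2 + (norm (V \<omega> - V' \<omega>))\<^sup>2) \<omega>)"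
    by (simp add: fun_eq_iff increment_bound_def cond_var_def)
  have "(\<integral>\<omega>. g \<omega> \<partial>M) = (\<integral>\<omega>. real_cond_exp M F g \<omega> \<partial>M)"
    using real_cond_exp_int(2)[OF g] by simp
  also have "\<dots> \<le> (\<integral>\<omega>. k * increment_bound M F h U U' V V' \<omega> \<partial>M)"
    using real_cond_exp_int(1)[OF g] le cond_var_integrable[OF U] real_cond_exp_int(1)[OF int]
    by (intro integral_mono_AE) (auto simp: eq)
  also have "\<dots> = k * ((\<integral>\<omega>. cond_var (\<lambda>\<omega>. U \<omega> - U' \<omega>) \<omega> \<partial>M) / h
    + ((\<integral>\<omega>. (U \<omega> - U' \<omega>)\<^sup>2 \<partial>M) + (\<integral>\<omega>. (norm (V \<omega> - V' \<omega>))\<^sup>2 \<partial>M)))"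
    using cond_var_integrable[OF U] real_cond_exp_int[OF int] L2_real_square[OF U] L2_D(2)[OF V]
    by (simp add: eq)
  finally show ?thesis by (simp add: add.assoc)
qed

end

section \<open>The scalar inequality behind one step\<close>

text \<open>Here \<open>v\<close> is the expected conditional variance, and \<open>z1\<close> and
  \<open>w1\<close> are the \<open>Z\<close>-error at the next time without and with a step as its
  weight. The coefficients of \<open>v\<close>, of \<open>y1\<close>, of \<open>w1\<close> and of
  the data \<open>a\<close>, \<open>b\<close> are compared separately.\<close>

lemma one_step_Lyapunov:
  fixes h K \<Lambda> \<rho> T \<eta> c :: real
  assumes h: "0 < h" "h \<le> T" and K: "0 < K" and \<Lambda>: "0 < \<Lambda>" and \<rho>: "1 \<le> \<rho>"
    and c_def: "c = 1 / (12 * \<Lambda>)" and \<eta>_def: "\<eta> = 8 * K + 3 * c * K + 4 * K * \<rho> / c"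
    and G_def: "G = \<eta> + 2 * (T + 1 / \<eta>) * K + 3 * c * T * K + (2 * K * \<rho> + 3 * c * K * \<rho>) / c"
    and R_def: "R = 2 * (T + 1 / \<eta>) + 3 * c"
    and nonneg: "0 \<le> v" "0 \<le> y1" "0 \<le> z1" "0 \<le> w1" "0 \<le> a" "0 \<le> b"
    and w1: "h * z1 \<le> \<rho> * w1"
    and y: "y \<le> (1 + \<eta> * h) * (y1 - v)
      + 2 * (1 + 1 / (\<eta> * h)) * (h\<^sup>2 * (K * (v / h + y1 + z1)) + a)"
    and z: "z \<le> 3 * (\<Lambda> / h * v + h\<^sup>2 * (K / h * (v / h + y1 + z1)) + b)"
  shows "y + c * (h * z) + c / 2 * w1 \<le> (1 + G * h) * (y1 + c * w1) + R * (h * (1 / h\<^sup>2 * a + b))"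
proof -
  have c: "0 < c" and c\<Lambda>: "3 * c * \<Lambda> = 1 / 4" using \<Lambda> by (auto simp: c_def)
  have \<eta>: "0 < \<eta>" using K c \<rho> by (auto simp: \<eta>_def intro!: add_pos_pos)
  \<comment> \<open>In turn, these control the coefficient of \<open>v\<close> free of
    \<open>h\<close>, the coefficient of \<open>v\<close> proportional to \<open>h\<close>, and the
    coefficient of \<open>w1\<close> free of \<open>h\<close>.\<close>
  have \<eta>1: "8 * K \<le> \<eta>" "2 * K + 3 * c * K \<le> \<eta>" "4 * K * \<rho> / c \<le> \<eta>"
    using K c \<rho> by (auto simp: \<eta>_def)
  define e where "e = 1 / \<eta>"
  have e: "0 < e" using \<eta> by (simp add: e_def)
  have \<eta>2: "2 * K * e \<le> 1 / 4" using \<eta>1(1) \<eta> by (simp add: e_def field_simps)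
  have \<eta>3: "2 * K * \<rho> * e \<le> c / 2" using \<eta>1(3) \<eta> c by (simp add: e_def field_simps)
  have y': "y \<le> (1 + \<eta> * h) * (y1 - v)
      + (2 * (h + e) * K * v + 2 * h * (h + e) * K * y1 + 2 * (h + e) * K * (h * z1) + 2 * (h + e) * (a / h))"
  proof -
    have "2 * (1 + 1 / (\<eta> * h)) * (h\<^sup>2 * (K * (v / h + y1 + z1)) + a)
      = 2 * (h + e) * K * v + 2 * h * (h + e) * K * y1 + 2 * (h + e) * K * (h * z1) + 2 * (h + e) * (a / h)"
      using h \<eta> by (simp add: e_def power2_eq_square field_simps)
    with y show ?thesis by simp
  qed
  have z': "h * z \<le> 3 * \<Lambda> * v + 3 * h * K * v + 3 * h\<^sup>2 * K * y1 + 3 * h * K * (h * z1) + 3 * h * b"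
  proof -
    have "h * z \<le> h * (3 * (\<Lambda> / h * v + h\<^sup>2 * (K / h * (v / h + y1 + z1)) + b))"
      using z h by (intro mult_left_mono) auto
    also have "\<dots> = 3 * \<Lambda> * v + 3 * h * K * v + 3 * h\<^sup>2 * K * y1 + 3 * h * K * (h * z1) + 3 * h * b"
      using h by (simp add: power2_eq_square field_simps)
    finally show ?thesis .
  qed
  have cz: "c * (h * z) \<le> 1 / 4 * v + 3 * c * h * K * v + 3 * c * h\<^sup>2 * K * y1 + 3 * c * h * K * (h * z1) + 3 * c * h * b"
  proof -
    have "c * (h * z) \<le> c * (3 * \<Lambda> * v + 3 * h * K * v + 3 * h\<^sup>2 * K * y1 + 3 * h * K * (h * z1) + 3 * h * b)"
      using z' c by (intro mult_left_mono) auto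
    also have "\<dots> = (3 * c * \<Lambda>) * v + 3 * c * h * K * v + 3 * c * h\<^sup>2 * K * y1 + 3 * c * h * K * (h * z1) + 3 * c * h * b"
      by (simp add: algebra_simps)
    finally show ?thesis unfolding c\<Lambda> .
  qed
  \<comment> \<open>The variance enters with -1 from the main term of \<open>y'\<close>, and with at
    most 1/4 each from the remainder of \<open>y'\<close> and from \<open>cz\<close>, up to terms of
    order \<open>h\<close>, which \<open>- \<eta> * h\<close> outweighs.\<close>
  have V: "(- (1 + \<eta> * h) + 2 * (h + e) * K + 1 / 4 + 3 * c * h * K) * v \<le> 0"
  proof -
    have "(2 * K + 3 * c * K) * h \<le> \<eta> * h" using \<eta>1(2) h by (intro mult_right_mono) auto
    then have "- (1 + \<eta> * h) + 2 * (h + e) * K + 1 / 4 + 3 * c * h * K \<le> 0"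
      using \<eta>2 by (simp add: algebra_simps)
    then show ?thesis using nonneg by (intro mult_nonpos_nonneg)
  qed
  have Gy: "(1 + \<eta> * h + 2 * h * (h + e) * K + 3 * c * h\<^sup>2 * K) * y1 \<le> (1 + G * h) * y1"
  proof -
    have "\<eta> + 2 * (h + e) * K + 3 * c * h * K \<le> G"
    proof -
      have "2 * (h + e) * K \<le> 2 * (T + e) * K" "3 * c * h * K \<le> 3 * c * T * K"
        using h K c by (auto intro!: mult_right_mono)
      moreover have "0 \<le> (2 * K * \<rho> + 3 * c * K * \<rho>) / c" using K c \<rho> by simp
      ultimately show ?thesis by (simp add: G_def e_def)
    qed
    then have "h * (\<eta> + 2 * (h + e) * K + 3 * c * h * K) \<le> h * G"
      using h by (intro mult_left_mono) auto
    then show ?thesis using nonneg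
      by (intro mult_right_mono) (auto simp: algebra_simps power2_eq_square)
  qed
  \<comment> \<open>One half of \<open>c\<close> bounds the part of the coefficient without a factor
    \<open>h\<close>, the other half is the extra \<open>c / 2 * w1\<close> on the left; whatever
    carries a factor \<open>h\<close> goes into \<open>G\<close>.\<close>
  have Gw: "(2 * (h + e) * K + 3 * c * h * K) * (h * z1) + c / 2 * w1 \<le> (1 + G * h) * (c * w1)"
  proof -
    have "(2 * (h + e) * K + 3 * c * h * K) * (h * z1) \<le> (2 * (h + e) * K + 3 * c * h * K) * (\<rho> * w1)"
      using w1 h e K c by (intro mult_left_mono) auto
    moreover have "(2 * (h + e) * K + 3 * c * h * K) * \<rho> \<le> c / 2 + h * (c * G)"
    proof -
      have "2 * K * \<rho> + 3 * c * K * \<rho> \<le> c * G"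
      proof -
        have "0 < T" using h by simp
        then have "(2 * K * \<rho> + 3 * c * K * \<rho>) / c \<le> G" using K c \<eta>
          by (simp add: G_def)
        then show ?thesis using c by (simp add: field_simps)
      qed
      then have "h * (2 * K * \<rho> + 3 * c * K * \<rho>) \<le> h * (c * G)"
        using h by (intro mult_left_mono) auto
      with \<eta>3 show ?thesis by (simp add: algebra_simps)
    qed
    then have "(2 * (h + e) * K + 3 * c * h * K) * \<rho> * w1 \<le> (c / 2 + h * (c * G)) * w1"
      using nonneg by (intro mult_right_mono)
    ultimately show ?thesis by (simp add: algebra_simps)
  qed
  have Ra: "2 * (h + e) * (a / h) + 3 * c * h * b \<le> R * (h * (1 / h\<^sup>2 * a + b))"
  proof -
    have "2 * (h + e) \<le> R" "3 * c \<le> R"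
      using h c e by (auto simp: R_def e_def[symmetric])
    then have "2 * (h + e) * (a / h) \<le> R * (a / h)" "3 * c * (h * b) \<le> R * (h * b)"
      using nonneg h by (intro mult_right_mono; simp)+
    moreover have "h * (1 / h\<^sup>2 * a + b) = a / h + h * b"
      using h by (simp add: power2_eq_square field_simps)
    ultimately show ?thesis by (simp add: algebra_simps)
  qed
  show ?thesis using y' cz V Gy Gw Ra by (simp add: algebra_simps)
qed

section \<open>Grids, the step ratio and a discrete Gronwall inequality\<close>

lemma grid_mono:
  assumes "is_grid T n t" "i \<le> j" "j \<le> n"
  shows "t i \<le> t j"
  using assms(2,3)
proof (induction j rule: dec_induct)
  case (step j)
  moreover have "t j < t (Suc j)" using assms(1) step by (auto simp: is_grid_def)
  ultimately show ?case by simp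
qed simp

lemma grid_bounds:
  assumes "is_grid T n t" "i \<le> n"
  shows "0 \<le> t i" "t i \<le> T"
  using grid_mono[OF assms(1), of 0 i] grid_mono[OF assms(1), of i n] assms by (auto simp: is_grid_def)

lemma grid_step:
  assumes "is_grid T n t" "i < n"
  shows "0 < step t i" "step t i \<le> T"
  using grid_bounds[OF assms(1), of i] grid_bounds[OF assms(1), of "Suc i"] assms
  by (auto simp: is_grid_def step_def)

lemma step_ratio_finite: "finite {step t i / step t (Suc i) | i. Suc i < n}"
proof -
  have "{step t i / step t (Suc i) | i. Suc i < n} \<subseteq> (\<lambda>i. step t i / step t (Suc i)) ` {..<n}"
    by auto
  then show ?thesis by (rule finite_subset) simp
qed

lemma step_ratio_ge_1: "1 \<le> step_ratio n t"
  unfolding step_ratio_def using step_ratio_finite[of t n] by (intro Max_ge) auto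

lemma step_le_step_ratio:
  assumes "is_grid T n t" "Suc i < n"
  shows "step t i \<le> step_ratio n t * step t (Suc i)"
proof -
  have "step t i / step t (Suc i) \<le> step_ratio n t"
    unfolding step_ratio_def using step_ratio_finite[of t n] assms(2) by (intro Max_ge) auto
  then show ?thesis using grid_step(1)[OF assms] by (simp add: field_simps)
qed

text \<open>Backward Gronwall inequality for \<open>S i = x i + c/2 * (w (i+1) + \<dots> + w n)\<close>, whose increments
  absorb the extra term \<open>c/2 * w (i+1)\<close>.\<close>

lemma backward_Gronwall:
  fixes x w r :: "nat \<Rightarrow> real"
  assumes grid: "is_grid T n t" and G: "0 \<le> G" and c: "0 \<le> c" and R: "0 \<le> R"
    and w: "\<And>i. i \<le> n \<Longrightarrow> 0 \<le> w i" and r: "\<And>i. i < n \<Longrightarrow> 0 \<le> r i" and xn: "0 \<le> x n"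
    and rec: "\<And>i. i < n \<Longrightarrow> x i + c * w (Suc i) \<le> (1 + G * step t i) * x (Suc i) + R * r i"
    and "i \<le> n"
  shows "x i + c * (\<Sum>j\<in>{i<..n}. w j) \<le> exp (G * (t n - t i)) * (x n + R * (\<Sum>j\<in>{i..<n}. r j))"
  using \<open>i \<le> n\<close>
proof (induction i rule: inc_induct)
  case base
  then show ?case by simp
next
  case (step i)
  let ?S = "x (Suc i) + c * (\<Sum>j\<in>{Suc i<..n}. w j)"
  let ?A = "x n + R * (\<Sum>j\<in>{Suc i..<n}. r j)"
  have i: "i < n" by (rule step.hyps)
  have h: "0 < step t i" by (rule grid_step[OF grid i])
  have W: "0 \<le> c * (\<Sum>j\<in>{Suc i<..n}. w j)" using c w by (auto intro!: mult_nonneg_nonneg sum_nonneg)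
  have A: "0 \<le> ?A" using xn R r by (auto intro!: add_nonneg_nonneg mult_nonneg_nonneg sum_nonneg)
  have Rr: "0 \<le> R * r i" using R r[OF i] by simp
  have "{i<..n} = insert (Suc i) {Suc i<..n}" using i by auto
  then have "x i + c * (\<Sum>j\<in>{i<..n}. w j) = x i + c * w (Suc i) + c * (\<Sum>j\<in>{Suc i<..n}. w j)"
    by (simp add: algebra_simps)
  also have "\<dots> \<le> (1 + G * step t i) * x (Suc i) + R * r i + c * (\<Sum>j\<in>{Suc i<..n}. w j)"
    using rec[OF i] by simp
  \<comment> \<open>The tail sum is nonnegative, so it may take the same growth factor as
    \<open>x (Suc i)\<close>.\<close>
  also have "\<dots> \<le> (1 + G * step t i) * ?S + R * r i"
    using mult_right_mono[of 1 "1 + G * step t i", OF _ W] G h by (simp add: distrib_left)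
  also have "\<dots> \<le> (1 + G * step t i) * (exp (G * (t n - t (Suc i))) * ?A) + R * r i"
    using step.IH G h by (intro add_right_mono mult_left_mono) auto
  also have "\<dots> \<le> exp (G * step t i) * (exp (G * (t n - t (Suc i))) * ?A) + R * r i"
    using A by (intro add_right_mono mult_right_mono) (auto simp: exp_ge_add_one_self)
  also have "\<dots> = exp (G * (t n - t i)) * ?A + R * r i"
    unfolding mult.assoc[symmetric] exp_add[symmetric] by (simp add: step_def algebra_simps)
  also have "\<dots> \<le> exp (G * (t n - t i)) * ?A + exp (G * (t n - t i)) * (R * r i)"
    using Rr G grid_mono[OF grid, of i n] i by (intro add_left_mono) (simp add: mult_le_cancel_right1)
  also have "\<dots> = exp (G * (t n - t i)) * (x n + R * (\<Sum>j\<in>{i..<n}. r j))"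
    using i by (simp add: sum.atLeast_Suc_lessThan algebra_simps)
  finally show ?case .
qed

text \<open>\<open>y i\<close> and \<open>z i\<close> stand for the second moments of the errors of the two components, \<open>v i\<close> for the
  expected conditional variance of the error of \<open>Y (i+1)\<close>, and \<open>a i\<close>, \<open>b i\<close> for the second moments of
  the projected perturbations.  The parameter \<open>\<eta>\<close> is the weight in Young's inequality.\<close>

definition error_recursion ::
  "real \<Rightarrow> real \<Rightarrow> nat \<Rightarrow> (nat \<Rightarrow> real) \<Rightarrow> (nat \<Rightarrow> real) \<Rightarrow> (nat \<Rightarrow> real)
    \<Rightarrow> (nat \<Rightarrow> real) \<Rightarrow> (nat \<Rightarrow> real) \<Rightarrow> (nat \<Rightarrow> real) \<Rightarrow> bool" where
  "error_recursion \<Lambda> K n h y z v a b \<longleftrightarrow>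
    (\<forall>i\<le>n. 0 \<le> y i \<and> 0 \<le> z i) \<and>
    (\<forall>i<n. 0 \<le> v i \<and> 0 \<le> a i \<and> 0 \<le> b i \<and>
      (\<forall>\<eta>>0. y i \<le> (1 + \<eta> * h i) * (y (Suc i) - v i) + 2 * (1 + 1 / (\<eta> * h i))
        * ((h i)\<^sup>2 * (K * (v i / h i + y (Suc i) + z (Suc i))) + a i)) \<and>
      z i \<le> 3 * (\<Lambda> / h i * v i
        + (h i)\<^sup>2 * (K / h i * (v i / h i + y (Suc i) + z (Suc i))) + b i))"

section \<open>Stability of the scalar recursion\<close>

text \<open>\<open>backward_Gronwall\<close> is applied to \<open>y i + c * w i\<close>: at a
  general \<open>i\<close> it bounds \<open>y i\<close>, and at \<open>i = 0\<close> its tail sum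
  bounds all \<open>Z\<close>-errors at once. The constant is fixed before the grid and the
  sequences, from \<open>T\<close>, \<open>\<Lambda>\<close>, \<open>K\<close> and
  \<open>\<rho>\<close> only.\<close>

lemma recursion_stability:
  fixes T \<Lambda> K \<rho> :: real
  assumes T: "0 < T" and \<Lambda>: "0 < \<Lambda>" and K: "0 < K"
  shows "\<exists>C>0. \<forall>n t y z v a b. is_grid T n t \<longrightarrow> step_ratio n t = \<rho> \<longrightarrow>
    error_recursion \<Lambda> K n (step t) y z v a b \<longrightarrow>
    Max (y ` {..n}) + (\<Sum>i<n. step t i * z i)
      \<le> C * (y n + step t (n - 1) * z n + (\<Sum>i<n. step t i * (1 / (step t i)\<^sup>2 * a i + b i)))"
proof (cases "1 \<le> \<rho>")
  case False
  \<comment> \<open>No grid has a step ratio below 1, so any positive constant will do.\<close>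
  then show ?thesis using step_ratio_ge_1 by (metis zero_less_one)
next
  case \<rho>: True
  define c where "c = 1 / (12 * \<Lambda>)"
  define \<eta> where "\<eta> = 8 * K + 3 * c * K + 4 * K * \<rho> / c"
  define G where "G = \<eta> + 2 * (T + 1 / \<eta>) * K + 3 * c * T * K + (2 * K * \<rho> + 3 * c * K * \<rho>) / c"
  define R where "R = 2 * (T + 1 / \<eta>) + 3 * c"
  have c: "0 < c" using \<Lambda> by (simp add: c_def)
  have \<eta>: "0 < \<eta>" using K c \<rho> by (auto simp: \<eta>_def intro!: add_pos_pos)
  have "0 \<le> 2 * (T + 1 / \<eta>) * K" "0 \<le> 3 * c * T * K" "0 \<le> (2 * K * \<rho> + 3 * c * K * \<rho>) / c"
    using K c \<rho> \<eta> T by auto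
  then have G: "0 \<le> G" using \<eta> by (simp add: G_def)
  have R: "0 < R" using c \<eta> T by (auto simp: R_def intro!: add_pos_pos)
  \<comment> \<open>The first factor adds the bounds for the maximum and for the sum, the
    exponential comes from Gronwall's inequality, and \<open>1 + c + R\<close> dominates the three
    weights of the data.\<close>
  let ?C = "(1 + 2 / c) * (exp (G * T) * (1 + c + R))"
  show ?thesis
  proof (intro exI[of _ ?C] conjI allI impI)
    show "0 < ?C" using c R by (intro mult_pos_pos add_pos_pos) auto
  next
    fix n t and y z v a b :: "nat \<Rightarrow> real"
    assume grid: "is_grid T n t" and ratio: "step_ratio n t = \<rho>"
      and rec: "error_recursion \<Lambda> K n (step t) y z v a b"
    from rec have yz: "\<forall>i\<le>n. 0 \<le> y i \<and> 0 \<le> z i" and vab: "\<forall>i<n. 0 \<le> v i \<and> 0 \<le> a i \<and> 0 \<le> b i"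
      and y: "\<forall>i<n. \<forall>\<eta>>0. y i \<le> (1 + \<eta> * step t i) * (y (Suc i) - v i) + 2 * (1 + 1 / (\<eta> * step t i))
        * ((step t i)\<^sup>2 * (K * (v i / step t i + y (Suc i) + z (Suc i))) + a i)"
      and z: "\<forall>i<n. z i \<le> 3 * (\<Lambda> / step t i * v i
        + (step t i)\<^sup>2 * (K / step t i * (v i / step t i + y (Suc i) + z (Suc i))) + b i)"
      unfolding error_recursion_def by blast+
    \<comment> \<open>No step starts at \<open>t n\<close>; the last step of the grid takes its
      place, which gives the terminal weight of the stability estimate.\<close>
    define w where "w i = (if i = n then step t (n - 1) else step t i) * z i" for i
    define r where "r i = step t i * (1 / (step t i)\<^sup>2 * a i + b i)" for i
    have n: "0 < n" using grid by (simp add: is_grid_def)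
    have h: "0 < step t i" "step t i \<le> T" if "i < n" for i
      using grid_step[OF grid that] by auto
    have w: "0 \<le> w i" if "i \<le> n" for i
      using that yz h[of i] h[of "n - 1"] n by (auto simp: w_def)
    have r: "0 \<le> r i" if "i < n" for i
      using that vab h[of i] by (auto simp: r_def)
    have Lyapunov: "y i + c * w i + c / 2 * w (Suc i)
        \<le> (1 + G * step t i) * (y (Suc i) + c * w (Suc i)) + R * r i" if i: "i < n" for i
    proof -
      \<comment> \<open>In the last step both sides carry the same step and
        \<open>1 \<le> \<rho>\<close> suffices; before it, two consecutive steps are compared by the
        step ratio.\<close>
      have "step t i * z (Suc i) \<le> \<rho> * w (Suc i)"
      proof (cases "Suc i = n")
        case True
        then show ?thesis using \<rho> w[of n] by (auto simp: w_def mult_le_cancel_right1)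
      next
        case False
        then have "step t i * z (Suc i) \<le> (\<rho> * step t (Suc i)) * z (Suc i)"
          using step_le_step_ratio[OF grid, of i] ratio i yz by (intro mult_right_mono) auto
        with False show ?thesis by (simp add: w_def mult.assoc)
      qed
      moreover have "0 \<le> v i" "0 \<le> y (Suc i)" "0 \<le> z (Suc i)" "0 \<le> a i" "0 \<le> b i"
        using i yz vab by auto
      ultimately have "y i + c * (step t i * z i) + c / 2 * w (Suc i)
          \<le> (1 + G * step t i) * (y (Suc i) + c * w (Suc i)) + R * (step t i * (1 / (step t i)\<^sup>2 * a i + b i))"
        using i w[of "Suc i"] y[rule_format, OF i \<eta>] z[rule_format, OF i]
        by (intro one_step_Lyapunov[OF h[OF i] K \<Lambda> \<rho> c_def \<eta>_def G_def R_def]) auto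
      with i show ?thesis by (simp add: w_def[of i] r_def)
    qed
    define B where "B = exp (G * T) * (y n + c * w n + R * (\<Sum>i<n. r i))"
    have r0: "(\<Sum>j\<in>{i..<n}. r j) \<le> (\<Sum>i<n. r i)" for i
      using r by (intro sum_mono2) auto
    have S: "y i + c * w i + c / 2 * (\<Sum>j\<in>{i<..n}. w j) \<le> B" if i: "i \<le> n" for i
    proof -
      have "y i + c * w i + c / 2 * (\<Sum>j\<in>{i<..n}. w j)
          \<le> exp (G * (t n - t i)) * (y n + c * w n + R * (\<Sum>j\<in>{i..<n}. r j))"
        by (rule backward_Gronwall[OF grid _ _ _ w r _ Lyapunov i]) (use G c R yz w in auto)
      also have "\<dots> \<le> B"
        unfolding B_def
      proof (rule mult_mono)
        show "exp (G * (t n - t i)) \<le> exp (G * T)"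
          using grid_bounds[OF grid i] grid_bounds[OF grid order_refl] G by (simp add: mult_left_mono)
        show "y n + c * w n + R * (\<Sum>j\<in>{i..<n}. r j) \<le> y n + c * w n + R * (\<Sum>i<n. r i)"
          using R r0 by simp
        show "0 \<le> y n + c * w n + R * (\<Sum>j\<in>{i..<n}. r j)"
          using R c r w yz by (auto intro!: add_nonneg_nonneg mult_nonneg_nonneg sum_nonneg)
      qed simp
      finally show ?thesis .
    qed
    have "y i \<le> B" if "i \<le> n" for i
    proof -
      have "0 \<le> c * w i + c / 2 * (\<Sum>j\<in>{i<..n}. w j)"
        using c w that by (auto intro!: add_nonneg_nonneg mult_nonneg_nonneg sum_nonneg)
      with S[OF that] show ?thesis by simp
    qed
    then have "Max (y ` {..n}) \<le> B" by (intro Max.boundedI) auto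
    moreover have "(\<Sum>i<n. step t i * z i) \<le> 2 / c * B"
    proof -
      have "(\<Sum>i<n. step t i * z i) = (\<Sum>i<n. w i)" by (intro sum.cong) (auto simp: w_def)
      \<comment> \<open>The nonnegative terminal term \<open>w n\<close> is added to match the tail
        sum of \<open>S\<close> at 0; the missing \<open>w 0\<close> is supplied by the summand
        \<open>c * w 0\<close> there.\<close>
      also have "\<dots> \<le> (\<Sum>i\<in>insert 0 {0<..n}. w i)" using w by (intro sum_mono2) auto
      also have "\<dots> = w 0 + (\<Sum>j\<in>{0<..n}. w j)" by simp
      finally have "c / 2 * (\<Sum>i<n. step t i * z i) \<le> c / 2 * (w 0 + (\<Sum>j\<in>{0<..n}. w j))"
        using c by (intro mult_left_mono) auto
      also have "\<dots> \<le> B"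
      proof -
        have "0 \<le> y 0" "0 \<le> c * w 0" using yz w[of 0] c by auto
        with S[of 0] show ?thesis unfolding distrib_left by linarith
      qed
      finally show ?thesis using c by (simp add: field_simps)
    qed
    ultimately have "Max (y ` {..n}) + (\<Sum>i<n. step t i * z i) \<le> (1 + 2 / c) * B"
      unfolding distrib_right by linarith
    also have "\<dots> \<le> (1 + 2 / c) * (exp (G * T) * ((1 + c + R) * (y n + w n + (\<Sum>i<n. r i))))"
    proof -
      have "0 \<le> y n" "0 \<le> w n" "0 \<le> (\<Sum>i<n. r i)" using yz w r by (auto intro!: sum_nonneg)
      then have "y n + c * w n + R * (\<Sum>i<n. r i) \<le> (1 + c + R) * (y n + w n + (\<Sum>i<n. r i))"
        using mult_right_mono[of 1 "1 + c + R" "y n"] mult_right_mono[of c "1 + c + R" "w n"]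
          mult_right_mono[of R "1 + c + R" "\<Sum>i<n. r i"] c R
        by (simp add: distrib_left)
      then show ?thesis unfolding B_def using c by (intro mult_left_mono) auto
    qed
    finally show "Max (y ` {..n}) + (\<Sum>i<n. step t i * z i)
      \<le> ?C * (y n + step t (n - 1) * z n + (\<Sum>i<n. step t i * (1 / (step t i)\<^sup>2 * a i + b i)))"
      by (simp add: w_def r_def mult.assoc)
  qed
qed

section \<open>Square-integrability of solutions and the stability theorem\<close>

text \<open>Backward induction from the terminal pair: the generators preserve square-integrability,
  and \<open>scheme_step_L2\<close> carries it through the conditional expectations.\<close>

lemma L2_perturbed_solution:
  fixes H :: "nat \<Rightarrow> 'a \<Rightarrow> real ^ 'd" and \<Phi>Z :: "('a, 'd, real ^ 'd) generator"
  assumes "filtered_prob_space M F" and grid: "is_grid T n t"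
    and scheme: "one_step_scheme M F \<Lambda> n t H \<Phi>Y \<Phi>Z"
    and \<zeta>: "\<And>i. i < n \<Longrightarrow> \<zeta>Y i \<in> L2 M (F (t (Suc i)))" "\<And>i. i < n \<Longrightarrow> \<zeta>Z i \<in> L2 M (F (t (Suc i)))"
    and sol: "perturbed_solution M F n t H \<Phi>Y \<Phi>Z \<zeta>Y \<zeta>Z Y Z"
    and "i \<le> n"
  shows "Y i \<in> L2 M (F (t i)) \<and> Z i \<in> L2 M (F (t i))"
  using \<open>i \<le> n\<close>
proof (induction i rule: inc_induct)
  case base
  then show ?case using sol by (simp add: perturbed_solution_def)
next
  case (step i)
  interpret filtered_prob_space M F by fact
  have i: "i < n" by (rule step.hyps)
  interpret finite_measure_subalgebra M "F (t i)"
    by unfold_locales (use subalgebra_F grid_bounds[OF grid, of i] i in auto)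
  have s: "0 \<le> t (Suc i)" using grid_bounds[OF grid, of "Suc i"] i by simp
  note to_M = L2_subalgebra[OF subalgebra_F[OF s]]
  note h = grid_step(1)[OF grid i]
  have H: "H i \<in> L2 M M" "AE \<omega> in M. vec_cond_exp M (F (t i)) (H i) \<omega> = 0"
    "AE \<omega> in M. real_cond_exp M (F (t i)) (\<lambda>\<omega>'. step t i * (norm (H i \<omega>'))\<^sup>2) \<omega> \<le> \<Lambda>"
    using scheme i to_M by (auto simp: one_step_scheme_def admissible_weights_def)
  have \<Phi>: "\<Phi>Y i (t (Suc i)) (Y (Suc i)) (Z (Suc i)) (step t i) \<in> L2 M M"
    "\<Phi>Z i (t (Suc i)) (Y (Suc i)) (Z (Suc i)) (step t i) \<in> L2 M M"
    using scheme i s h step.IH by (auto simp: one_step_scheme_def generator_maps_L2_def intro!: to_M)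
  have Y: "Y (Suc i) \<in> L2 M M" using step.IH to_M by blast
  show ?case
    using scheme_step_L2[OF Y \<Phi> to_M[OF \<zeta>(1)[OF i]] to_M[OF \<zeta>(2)[OF i]] H(1) h H(2,3), of "Y i" "Z i"]
      sol i by (simp add: perturbed_solution_def)
qed

theorem theorem1p1:
  fixes T \<Lambda> K :: real
  assumes "0 < T" and "0 < \<Lambda>" and "0 < K"
  shows "\<exists>C :: real \<Rightarrow> real. (\<forall>r. 0 < C r) \<and>
    (\<forall>(M :: 'a measure) F (W :: real \<Rightarrow> 'a \<Rightarrow> real ^ 'd) n t H \<Phi>Y \<Phi>Z.
      brownian_motion M F W \<longrightarrow>
      is_grid T n t \<longrightarrow>
      one_step_scheme M F \<Lambda> n t H \<Phi>Y (\<Phi>Z :: ('a, 'd, real ^ 'd) generator) \<longrightarrow>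
      generators_Lipschitz M F K n t \<Phi>Y \<Phi>Z \<longrightarrow>
      L2_stable M F n t H \<Phi>Y \<Phi>Z (C (step_ratio n t)))"
proof -
  let ?S = "\<lambda>\<rho> C. 0 < C \<and> (\<forall>n t y z v a b. is_grid T n t \<longrightarrow> step_ratio n t = \<rho> \<longrightarrow>
    error_recursion \<Lambda> K n (step t) y z v a b \<longrightarrow>
    Max (y ` {..n}) + (\<Sum>i<n. step t i * z i)
      \<le> C * (y n + step t (n - 1) * z n + (\<Sum>i<n. step t i * (1 / (step t i)\<^sup>2 * a i + b i))))"
  \<comment> \<open>A constant is fixed for every value of the step ratio before any probability
    space or grid is introduced; choice makes it a function of that value.\<close>
  have "\<forall>\<rho>. \<exists>C. ?S \<rho> C"
    by (rule allI) (rule recursion_stability[OF assms])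
  then have "\<exists>C. \<forall>\<rho>. ?S \<rho> (C \<rho>)"
    by (rule choice)
  then obtain C where stable: "\<forall>\<rho>. ?S \<rho> (C \<rho>)"
    by (rule exE)
  show ?thesis
  proof (intro exI[of _ C] conjI allI impI)
    show "0 < C r" for r using stable by blast
  next
    fix M :: "'a measure" and F and W :: "real \<Rightarrow> 'a \<Rightarrow> real ^ 'd" and n t H \<Phi>Y
      and \<Phi>Z :: "('a, 'd, real ^ 'd) generator"
    assume "brownian_motion M F W" and grid: "is_grid T n t"
      and scheme: "one_step_scheme M F \<Lambda> n t H \<Phi>Y \<Phi>Z"
      and Lip: "generators_Lipschitz M F K n t \<Phi>Y \<Phi>Z"
    then interpret brownian_motion M F W by simp
    note filtered = filtered_prob_space_axioms
    show "L2_stable M F n t H \<Phi>Y \<Phi>Z (C (step_ratio n t))"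
      unfolding L2_stable_def
    proof (intro allI impI)
      fix \<zeta>Y \<zeta>Z Y Z Y' Z'
      assume \<zeta>: "\<forall>i<n. \<zeta>Y i \<in> L2 M (F (t (Suc i))) \<and> \<zeta>Z i \<in> L2 M (F (t (Suc i)))"
        and sol: "scheme_solution M F n t H \<Phi>Y \<Phi>Z Y Z"
        and sol': "perturbed_solution M F n t H \<Phi>Y \<Phi>Z \<zeta>Y \<zeta>Z Y' Z'"
      \<comment> \<open>\<open>cond_var\<close> is written with its locale parameters, because the
        conditioning sigma-algebra varies with \<open>i\<close>. In \<open>v i\<close> the error at
        the next time is conditioned on the current one.\<close>
      define y z v a b where "y i = (\<integral>\<omega>. (Y i \<omega> - Y' i \<omega>)\<^sup>2 \<partial>M)"
        and "z i = (\<integral>\<omega>. (norm (Z i \<omega> - Z' i \<omega>))\<^sup>2 \<partial>M)"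
        and "v i = (\<integral>\<omega>. finite_measure_subalgebra.cond_var M (F (t i)) (\<lambda>\<omega>. Y (Suc i) \<omega> - Y' (Suc i) \<omega>) \<omega> \<partial>M)"
        and "a i = (\<integral>\<omega>. (real_cond_exp M (F (t i)) (\<zeta>Y i) \<omega>)\<^sup>2 \<partial>M)"
        and "b i = (\<integral>\<omega>. (norm (vec_cond_exp M (F (t i)) (\<zeta>Z i) \<omega>))\<^sup>2 \<partial>M)" for i
      have sub: "finite_measure_subalgebra M (F (t i))" if "i \<le> n" for i
        by unfold_locales (use subalgebra_F grid_bounds[OF grid that] in auto)
      have L2F: "Y i \<in> L2 M (F (t i))" "Z i \<in> L2 M (F (t i))"
        "Y' i \<in> L2 M (F (t i))" "Z' i \<in> L2 M (F (t i))" if "i \<le> n" for i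
        using L2_perturbed_solution[OF filtered grid scheme _ _ sol that]
          L2_perturbed_solution[OF filtered grid scheme _ _ sol' that] \<zeta>
        by (auto simp: L2_def)
      have to_M: "X \<in> L2 M M" if "X \<in> L2 M (F (t i))" "i \<le> n"
        for i and X :: "'a \<Rightarrow> 'b::real_normed_vector"
        using L2_subalgebra[OF subalgebra_F that(1)] grid_bounds[OF grid that(2)] by simp
      have \<delta>Y: "(\<lambda>\<omega>. Y i \<omega> - Y' i \<omega>) \<in> L2 M M" and \<delta>Z: "(\<lambda>\<omega>. Z i \<omega> - Z' i \<omega>) \<in> L2 M M"
        if "i \<le> n" for i
      proof -
        interpret finite_measure_subalgebra M "F (t i)" by (rule sub[OF that])
        show "(\<lambda>\<omega>. Y i \<omega> - Y' i \<omega>) \<in> L2 M M" "(\<lambda>\<omega>. Z i \<omega> - Z' i \<omega>) \<in> L2 M M"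
          by (intro L2_diff[OF subalgebra_refl] L2F[OF that, THEN to_M[OF _ that]])+
      qed
      have step: "0 \<le> v i
          \<and> (\<forall>\<eta>>0. y i \<le> (1 + \<eta> * step t i) * (y (Suc i) - v i) + 2 * (1 + 1 / (\<eta> * step t i))
            * ((step t i)\<^sup>2 * (K * (v i / step t i + y (Suc i) + z (Suc i))) + a i))
          \<and> z i \<le> 3 * (\<Lambda> / step t i * v i
            + (step t i)\<^sup>2 * (K / step t i * (v i / step t i + y (Suc i) + z (Suc i))) + b i)
          \<and> (\<integral>\<omega>. 1 / (step t i)\<^sup>2 * (real_cond_exp M (F (t i)) (\<zeta>Y i) \<omega>)\<^sup>2
              + (norm (vec_cond_exp M (F (t i)) (\<zeta>Z i) \<omega>))\<^sup>2 \<partial>M) = 1 / (step t i)\<^sup>2 * a i + b i"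
        if i: "i < n" for i
      proof -
        interpret finite_measure_subalgebra M "F (t i)" by (rule sub) (use i in simp)
        let ?h = "step t i" and ?s = "t (Suc i)"
        let ?Q = "\<Phi>Y i ?s (Y (Suc i)) (Z (Suc i)) ?h" and ?Q' = "\<Phi>Y i ?s (Y' (Suc i)) (Z' (Suc i)) ?h"
        let ?P = "\<Phi>Z i ?s (Y (Suc i)) (Z (Suc i)) ?h" and ?P' = "\<Phi>Z i ?s (Y' (Suc i)) (Z' (Suc i)) ?h"
        let ?A = "v i / ?h + y (Suc i) + z (Suc i)"
        have i': "i \<le> n" "Suc i \<le> n" using i by auto
        note h = grid_step(1)[OF grid i] and s = grid_bounds(1)[OF grid i'(2)]
        have H: "H i \<in> L2 M M" "AE \<omega> in M. vec_cond_exp M (F (t i)) (H i) \<omega> = 0"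
          "AE \<omega> in M. real_cond_exp M (F (t i)) (\<lambda>\<omega>'. ?h * (norm (H i \<omega>'))\<^sup>2) \<omega> \<le> \<Lambda>"
          using scheme i to_M[OF _ i'(2)] by (auto simp: one_step_scheme_def admissible_weights_def)
        have \<Phi>: "?Q \<in> L2 M M" "?Q' \<in> L2 M M" "?P \<in> L2 M M" "?P' \<in> L2 M M"
          using scheme i s h L2F[OF i'(2)]
          by (auto simp: one_step_scheme_def generator_maps_L2_def intro!: to_M[OF _ i'(2)])
        note U = L2F(1,3)[OF i'(2), THEN to_M[OF _ i'(2)]]
        have \<zeta>M: "\<zeta>Y i \<in> L2 M M" "\<zeta>Z i \<in> L2 M M"
          using \<zeta> i to_M[OF _ i'(2)] by auto
        have \<delta>Q: "(\<lambda>\<omega>. ?Q \<omega> - ?Q' \<omega>) \<in> L2 M M" and \<delta>P: "(\<lambda>\<omega>. ?P \<omega> - ?P' \<omega>) \<in> L2 M M"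
          by (intro L2_diff subalgebra_refl \<Phi>)+
        have Q: "(\<integral>\<omega>. (?Q \<omega> - ?Q' \<omega>)\<^sup>2 \<partial>M) \<le> K * ?A"
          unfolding v_def y_def z_def using Lip i L2F[OF i'(2)]
          by (intro integral_le_increment_bound[OF L2_real_square[OF \<delta>Q] \<delta>Y[OF i'(2)] \<delta>Z[OF i'(2)]])
             (simp add: generators_Lipschitz_def)
        have P: "(\<integral>\<omega>. (norm (?P \<omega> - ?P' \<omega>))\<^sup>2 \<partial>M) \<le> K / ?h * ?A"
          unfolding v_def y_def z_def using Lip i L2F[OF i'(2)]
          by (intro integral_le_increment_bound[OF L2_D(2)[OF \<delta>P] \<delta>Y[OF i'(2)] \<delta>Z[OF i'(2)]])
             (simp add: generators_Lipschitz_def)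
        have "y i \<le> (1 + \<theta>) * (y (Suc i) - v i) + 2 * (1 + 1 / \<theta>) * (?h\<^sup>2 * (K * ?A) + a i)"
          if \<theta>: "0 < \<theta>" for \<theta>
        proof -
          have "y i \<le> (1 + \<theta>) * (y (Suc i) - v i)
              + 2 * (1 + 1 / \<theta>) * (?h\<^sup>2 * (\<integral>\<omega>. (?Q \<omega> - ?Q' \<omega>)\<^sup>2 \<partial>M) + a i)"
            unfolding y_def v_def a_def
            using sol sol' i
            by (intro real_step_estimate[OF \<delta>Y[OF i'(2)] \<delta>Q \<zeta>M(1) \<delta>Y[OF i'(1)] _ \<theta>]
                  real_scheme_difference[OF U \<Phi>(1,2) \<zeta>M(1)])
               (auto simp: perturbed_solution_def)
          also have "\<dots> \<le> (1 + \<theta>) * (y (Suc i) - v i) + 2 * (1 + 1 / \<theta>) * (?h\<^sup>2 * (K * ?A) + a i)"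
            using \<theta> Q by (intro add_left_mono mult_left_mono add_right_mono) auto
          finally show ?thesis .
        qed
        \<comment> \<open>The free weight \<open>\<theta>\<close> is taken as
          \<open>\<eta> * ?h\<close>, so that the growth factor over the whole grid stays
          bounded.\<close>
        then have "\<forall>\<eta>>0. y i \<le> (1 + \<eta> * ?h) * (y (Suc i) - v i)
            + 2 * (1 + 1 / (\<eta> * ?h)) * (?h\<^sup>2 * (K * ?A) + a i)"
          using h by simp
        moreover have "z i \<le> 3 * (\<Lambda> / ?h * v i + ?h\<^sup>2 * (K / ?h * ?A) + b i)"
        proof -
          have "z i \<le> 3 * (\<Lambda> / ?h * v i + ?h\<^sup>2 * (\<integral>\<omega>. (norm (?P \<omega> - ?P' \<omega>))\<^sup>2 \<partial>M) + b i)"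
            unfolding z_def v_def b_def
            using sol sol' i
            by (intro vec_step_estimate[OF \<delta>Y[OF i'(2)] \<delta>P \<zeta>M(2) \<delta>Z[OF i'(1)] H(1) h H(2,3)]
                  vec_scheme_difference[OF U \<Phi>(3,4) \<zeta>M(2) H(1)])
               (auto simp: perturbed_solution_def)
          also have "\<dots> \<le> 3 * (\<Lambda> / ?h * v i + ?h\<^sup>2 * (K / ?h * ?A) + b i)"
            using P by (intro mult_left_mono add_left_mono add_right_mono) auto
          finally show ?thesis .
        qed
        moreover have "(\<integral>\<omega>. 1 / ?h\<^sup>2 * (real_cond_exp M (F (t i)) (\<zeta>Y i) \<omega>)\<^sup>2
              + (norm (vec_cond_exp M (F (t i)) (\<zeta>Z i) \<omega>))\<^sup>2 \<partial>M) = 1 / ?h\<^sup>2 * a i + b i"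
          unfolding a_def b_def
          using L2_real_square[OF real_cond_exp_L2[OF \<zeta>M(1)]] L2_D(2)[OF vec_cond_exp_L2[OF \<zeta>M(2)]]
          by simp
        moreover have "0 \<le> v i"
          unfolding v_def by (rule integral_cond_var_nonneg[OF \<delta>Y[OF i'(2)]])
        ultimately show ?thesis by blast
      qed
      have "Max (y ` {..n}) + (\<Sum>i<n. step t i * z i)
          \<le> C (step_ratio n t) * (y n + step t (n - 1) * z n
            + (\<Sum>i<n. step t i * (1 / (step t i)\<^sup>2 * a i + b i)))"
      \<comment> \<open>The parameter \<open>\<rho>\<close> is the step ratio of the grid itself,
        whence \<open>refl\<close>.\<close>
      proof (rule stable[THEN spec, THEN conjunct2, rule_format, OF grid refl])
        have "0 \<le> y i" "0 \<le> z i" "0 \<le> a i" "0 \<le> b i" for i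
          by (simp_all add: y_def z_def a_def b_def)
        with step show "error_recursion \<Lambda> K n (step t) y z v a b"
          unfolding error_recursion_def by blast
      qed
      moreover have "(\<integral>\<omega>. (Y n \<omega> - Y' n \<omega>)\<^sup>2 + step t (n - 1) * (norm (Z n \<omega> - Z' n \<omega>))\<^sup>2 \<partial>M)
          = y n + step t (n - 1) * z n"
        unfolding y_def z_def using L2_real_square[OF \<delta>Y[of n]] L2_D(2)[OF \<delta>Z[of n]] by simp
      moreover have "(\<Sum>i<n. step t i * (\<integral>\<omega>. 1 / (step t i)\<^sup>2 * (real_cond_exp M (F (t i)) (\<zeta>Y i) \<omega>)\<^sup>2
              + (norm (vec_cond_exp M (F (t i)) (\<zeta>Z i) \<omega>))\<^sup>2 \<partial>M))
          = (\<Sum>i<n. step t i * (1 / (step t i)\<^sup>2 * a i + b i))"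
        by (intro sum.cong refl arg_cong2[where f = "(*)"]) (use step in auto)
      ultimately show "Max ((\<lambda>i. \<integral>\<omega>. (Y i \<omega> - Y' i \<omega>)\<^sup>2 \<partial>M) ` {..n})
        + (\<Sum>i<n. step t i * (\<integral>\<omega>. (norm (Z i \<omega> - Z' i \<omega>))\<^sup>2 \<partial>M))
      \<le> C (step_ratio n t)
        * ((\<integral>\<omega>. (Y n \<omega> - Y' n \<omega>)\<^sup>2 + step t (n - 1) * (norm (Z n \<omega> - Z' n \<omega>))\<^sup>2 \<partial>M)
        + (\<Sum>i<n. step t i *
            (\<integral>\<omega>. 1 / (step t i)\<^sup>2 * (real_cond_exp M (F (t i)) (\<zeta>Y i) \<omega>)\<^sup>2
              + (norm (vec_cond_exp M (F (t i)) (\<zeta>Z i) \<omega>))\<^sup>2 \<partial>M)))"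
        by (simp only: y_def[abs_def] z_def[abs_def])
    qed
  qed
qed

end
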